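(* Let \(n\ge2\) and let \(A\) be any real skew-symmetric \(n\times n\) matrix. The skew-determinantal flip–repair walk \(P\) associated with \(A\) has spectral gap at least \(2/n\), i.e. \(\mathcal E_P(f,f)\ge \frac{2}{n}\mathrm{Var}_\mu(f)\) for every \(f:\Omega\to\mathbb R\). Moreover the constant \(2/n\) is sharp: for every \(n\ge2\) there is a real skew-symmetric \(n\times n\) matrix for which the spectral gap equals \(2/n\).
   Context: For \(S\subseteq[n]\) write \(A_S\) for the principal submatrix of \(A\) on \(S\), \(w(S)=\det(A_S)\) (with \(\det\) of the empty matrix equal to \(1\)); these are nonnegative and vanish for odd \(|S|\). Let \(Z=\sum_{S\subseteq[n]}w(S)\), \(\Omega=\{S: w(S)>0\}\), and \(\mu(S)=w(S)/Z\) on \(\Omega\). The flip–repair walk \(P\) on \(\Omega\): from \(S\in\Omega\), choose \(i\in[n]\) uniformly and set \(Y=S\triangle\{i\}\); then move to \(T\in\Omega\) with \(|T\triangle Y|=1\) with probability \(w(T)/\sum_{j=1}^n w(Y\triangle\{j\})\). It is reversible with respect to \(\mu\). The Dirichlet form is \(\mathcal E_P(f,f)=\langle f,(I-P)f\rangle_\mu=\frac12\sum_{x,y}\mu(x)P(x,y)(f(x)-f(y))^2\). The spectral gap is the largest constant \(\gamma\) with \(\mathcal E_P(f,f)\ge\gamma\,\mathrm{Var}_\mu(f)\) for all \(f\), with the convention that it equals \(1\) when \(|\Omega|=1\). *)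

theory Defs
  imports Complex_Main
    "Jordan_Normal_Form.Determinant"
    "Jordan_Normal_Form.DL_Submatrix"
begin

text \<open>
  A kernel on a finite state space \<open>X\<close> is given by its transition probabilities \<open>P x y\<close> and a
  distribution on \<open>X\<close> by its point masses \<open>\<mu> x\<close>. Only the values on \<open>X\<close> matter, so a test
  function \<open>X \<rightarrow> \<real>\<close> is represented by a total function.
\<close>

definition inner_on :: "'s set \<Rightarrow> ('s \<Rightarrow> real) \<Rightarrow> ('s \<Rightarrow> real) \<Rightarrow> ('s \<Rightarrow> real) \<Rightarrow> real" where
  "inner_on X \<mu> f g = (\<Sum>x\<in>X. \<mu> x * f x * g x)"

definition mean_on :: "'s set \<Rightarrow> ('s \<Rightarrow> real) \<Rightarrow> ('s \<Rightarrow> real) \<Rightarrow> real" where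
  "mean_on X \<mu> f = (\<Sum>x\<in>X. \<mu> x * f x)"

definition variance_on :: "'s set \<Rightarrow> ('s \<Rightarrow> real) \<Rightarrow> ('s \<Rightarrow> real) \<Rightarrow> real" where
  "variance_on X \<mu> f = mean_on X \<mu> (\<lambda>x. (f x - mean_on X \<mu> f)\<^sup>2)"

definition apply_kernel :: "'s set \<Rightarrow> ('s \<Rightarrow> 's \<Rightarrow> real) \<Rightarrow> ('s \<Rightarrow> real) \<Rightarrow> 's \<Rightarrow> real" where
  "apply_kernel X P f x = (\<Sum>y\<in>X. P x y * f y)"

definition dirichlet_form ::
  "'s set \<Rightarrow> ('s \<Rightarrow> real) \<Rightarrow> ('s \<Rightarrow> 's \<Rightarrow> real) \<Rightarrow> ('s \<Rightarrow> real) \<Rightarrow> real" where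
  "dirichlet_form X \<mu> P f = inner_on X \<mu> f (\<lambda>x. f x - apply_kernel X P f x)"

definition spectral_gap :: "'s set \<Rightarrow> ('s \<Rightarrow> real) \<Rightarrow> ('s \<Rightarrow> 's \<Rightarrow> real) \<Rightarrow> real" where
  "spectral_gap X \<mu> P =
    (if card X = 1 then 1
     else (GREATEST \<gamma>. \<forall>f. dirichlet_form X \<mu> P f \<ge> \<gamma> * variance_on X \<mu> f))"

text \<open>
  Rows and columns of an \<open>n \<times> n\<close> matrix are indexed by \<open>{..<n}\<close> instead of \<open>{1..n}\<close>.
\<close>

definition weight :: "real mat \<Rightarrow> nat set \<Rightarrow> real" where
  "weight A S = det (submatrix A S S)"

definition partition_function :: "real mat \<Rightarrow> real" where
  "partition_function A = (\<Sum>S\<in>Pow {..<dim_row A}. weight A S)"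

definition states :: "real mat \<Rightarrow> nat set set" where
  "states A = {S. S \<subseteq> {..<dim_row A} \<and> weight A S > 0}"

definition skew_det_measure :: "real mat \<Rightarrow> nat set \<Rightarrow> real" where
  "skew_det_measure A S = weight A S / partition_function A"

text \<open>
  The denominator is positive whenever \<open>Y\<close> arises by flipping one index of a state of a
  skew-symmetric matrix, since flipping that index back is one of the summands.
\<close>

definition repair_prob :: "real mat \<Rightarrow> nat set \<Rightarrow> nat set \<Rightarrow> real" where
  "repair_prob A Y T =
    (if T \<in> states A \<and> card (sym_diff T Y) = 1
     then weight A T / (\<Sum>j<dim_row A. weight A (sym_diff Y {j}))
     else 0)"

definition flip_repair :: "real mat \<Rightarrow> nat set \<Rightarrow> nat set \<Rightarrow> real" where
  "flip_repair A S T =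
    (\<Sum>i<dim_row A. 1 / real (dim_row A) * repair_prob A (sym_diff S {i}) T)"

end

theory Submission
  imports Defs
begin

text \<open>
  A Pfaffian row expansion defines \<open>\<psi>\<close> with \<open>\<psi>(S)\<^sup>2 = det(A\<^sub>S)\<close>. As a vector in the fermionic Fock
  space with basis the subsets of \<open>{..<n}\<close>, it is a Gaussian state: with
  \<open>R = (1 - A)\<^sup>-\<^sup>1\<close>, the operators \<open>d\<^sub>j = \<Sum>\<^sub>k R\<^sub>j\<^sub>k (a\<^sub>k - \<Sum>\<^sub>l A\<^sub>k\<^sub>l a\<^sub>l*)\<close> satisfy the canonical
  anticommutation relations and \<open>\<psi>\<close> spans their common kernel.

  For a test function \<open>f\<close> with mean \<open>m\<close>, the vector \<open>\<phi> = (f - m)\<psi>\<close> is even and orthogonal to the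
  vacuum \<open>\<psi>\<close>, so it contains at least two particles:
  \<open>\<Sum>\<^sub>j \<parallel>d\<^sub>j \<phi>\<parallel>\<^sup>2 \<ge> 2 \<parallel>\<phi>\<parallel>\<^sup>2\<close>, which is the variance up to normalisation. Conversely, at an intermediate set
  \<open>Y\<close> the value \<open>(d\<^sub>j \<phi>)(Y)\<close> is a coefficient, with respect to an orthonormal system, of the vector of
  values of \<open>f\<psi>\<close> at the neighbours of \<open>Y\<close>. Since \<open>d\<^sub>j \<psi> = 0\<close>, any multiple of \<open>\<psi>\<close> may be
  subtracted first; with the optimal multiple, Bessel's inequality bounds
  \<open>\<Sum>\<^sub>j (d\<^sub>j \<phi>)(Y)\<^sup>2\<close> by the conditional variance of \<open>f\<close> given \<open>Y\<close>, and these add up to the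
  Dirichlet form. A single nonzero \<open>2 \<times> 2\<close> block attains equality.
\<close>

subsection \<open>Flip operators\<close>

definition flip :: "nat set \<Rightarrow> nat \<Rightarrow> nat set" where
  "flip Y k = sym_diff Y {k}"

definition sgn_below :: "nat \<Rightarrow> nat set \<Rightarrow> real" where
  "sgn_below k Y = (-1) ^ card {i\<in>Y. i < k}"

definition ip :: "nat \<Rightarrow> (nat set \<Rightarrow> real) \<Rightarrow> (nat set \<Rightarrow> real) \<Rightarrow> real" where
  "ip n f g = (\<Sum>Y\<in>Pow {..<n}. f Y * g Y)"

text \<open>
  The operator \<open>\<Sum>\<^sub>k (u\<^sub>k a\<^sub>k + v\<^sub>k a\<^sub>k*)\<close> for the annihilators \<open>a\<^sub>k\<close> and creators \<open>a\<^sub>k*\<close>, with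
  the Jordan--Wigner signs.
\<close>

definition clifford ::
  "nat \<Rightarrow> (nat \<Rightarrow> real) \<Rightarrow> (nat \<Rightarrow> real) \<Rightarrow> (nat set \<Rightarrow> real) \<Rightarrow> nat set \<Rightarrow> real" where
  "clifford n u v f Y = (\<Sum>k<n. (if k \<in> Y then v k else u k) * sgn_below k Y * f (flip Y k))"

lemma mem_flip [simp]: "i \<in> flip Y k \<longleftrightarrow> (i \<in> Y \<longleftrightarrow> i \<noteq> k)"
  by (auto simp: flip_def)

lemma flip_flip [simp]: "flip (flip Y k) k = Y"
  by auto

lemma flip_commute: "flip (flip Y k) l = flip (flip Y l) k"
  by auto

lemma finite_flip [simp]: "finite (flip Y k) \<longleftrightarrow> finite Y"
  by (auto simp: flip_def)

lemma sgn_below_squared: "sgn_below k Y * sgn_below k Y = 1"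
  by (simp add: sgn_below_def flip: power_mult_distrib)

lemma sgn_below_flip:
  "sgn_below k (flip Y l) = (if l < k then - sgn_below k Y else sgn_below k Y)"
proof (cases "l < k")
  case True
  show ?thesis
  proof (cases "l \<in> Y")
    case True
    have "{i\<in>Y. i < k} = insert l {i\<in>flip Y l. i < k}"
      using True \<open>l < k\<close> by auto
    moreover have "card (insert l {i\<in>flip Y l. i < k}) = Suc (card {i\<in>flip Y l. i < k})"
      using True by (intro card_insert_disjoint) auto
    ultimately show ?thesis
      using \<open>l < k\<close> unfolding sgn_below_def by simp
  next
    case False
    have "{i\<in>flip Y l. i < k} = insert l {i\<in>Y. i < k}"
      using False \<open>l < k\<close> by auto
    moreover have "card (insert l {i\<in>Y. i < k}) = Suc (card {i\<in>Y. i < k})"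
      using False by (intro card_insert_disjoint) auto
    ultimately show ?thesis
      using \<open>l < k\<close> unfolding sgn_below_def by simp
  qed
next
  case False
  then have "{i\<in>flip Y l. i < k} = {i\<in>Y. i < k}"
    by auto
  then show ?thesis
    using False unfolding sgn_below_def by simp
qed

text \<open>Exactly one of the two indices lies below the other, so exactly one order of flipping
  picks up a minus sign. This is the source of fermionic anticommutation.\<close>

lemma sgn_below_flip_swap:
  assumes "k \<noteq> l"
  shows "sgn_below k Y * sgn_below l (flip Y k) = - (sgn_below l Y * sgn_below k (flip Y l))"
  using assms by (auto simp: sgn_below_flip)

text \<open>Expand both compositions into pairs of flips. For distinct indices the two orders reach
  the same set with opposite signs and cancel; flipping one index twice returns to \<open>Y\<close>
  and leaves the scalar.\<close>

lemma clifford_anticommutator: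
  "clifford n u v (clifford n u' v' f) Y + clifford n u' v' (clifford n u v f) Y
    = (\<Sum>k<n. u k * v' k + v k * u' k) * f Y"
proof -
  define c where "c k X = (if k \<in> X then v k else u k)" for k X
  define c' where "c' k X = (if k \<in> X then v' k else u' k)" for k X
  define t where "t k l = c k Y * sgn_below k Y * (c' l (flip Y k) * sgn_below l (flip Y k)
      * f (flip (flip Y k) l))" for k l
  define t' where "t' l k = c' l Y * sgn_below l Y * (c k (flip Y l) * sgn_below k (flip Y l)
      * f (flip (flip Y l) k))" for l k
  have off: "t k l + t' l k = 0" if "k \<noteq> l" for k l
  proof -
    have "c' l (flip Y k) = c' l Y" "c k (flip Y l) = c k Y"
      using that by (auto simp: c_def c'_def)
    then have "t k l + t' l k = c k Y * c' l Y * f (flip (flip Y k) l) *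
       (sgn_below k Y * sgn_below l (flip Y k) + sgn_below l Y * sgn_below k (flip Y l))"
      by (simp add: t_def t'_def flip_commute[of Y l k] algebra_simps)
    then show ?thesis
      using sgn_below_flip_swap[OF that, of Y] by simp
  qed
  have diag: "t k k + t' k k = (u k * v' k + v k * u' k) * f Y" for k
  proof -
    have s: "sgn_below k (flip Y k) = sgn_below k Y"
      by (simp add: sgn_below_flip)
    have "t k k + t' k k =
        (c k Y * c' k (flip Y k) + c' k Y * c k (flip Y k)) * (sgn_below k Y * sgn_below k Y) * f Y"
      unfolding t_def t'_def s flip_flip by (simp add: algebra_simps)
    also have "c k Y * c' k (flip Y k) + c' k Y * c k (flip Y k) = u k * v' k + v k * u' k"
      by (auto simp: c_def c'_def)
    finally show ?thesis
      by (simp add: sgn_below_squared)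
  qed
  have "clifford n u v (clifford n u' v' f) Y = (\<Sum>k<n. \<Sum>l<n. t k l)"
    by (simp add: clifford_def t_def c_def c'_def sum_distrib_left)
  moreover have "clifford n u' v' (clifford n u v f) Y = (\<Sum>l<n. \<Sum>k<n. t' l k)"
    by (simp add: clifford_def t'_def c_def c'_def sum_distrib_left)
  moreover have "(\<Sum>l<n. \<Sum>k<n. t' l k) = (\<Sum>k<n. \<Sum>l<n. t' l k)"
    by (rule sum.swap)
  ultimately have "clifford n u v (clifford n u' v' f) Y + clifford n u' v' (clifford n u v f) Y
      = (\<Sum>k<n. \<Sum>l<n. t k l + t' l k)"
    by (simp add: sum.distrib)
  also have "\<dots> = (\<Sum>k<n. \<Sum>l<n. if l = k then (u k * v' k + v k * u' k) * f Y else 0)"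
    using off diag by (intro sum.cong refl) metis
  also have "\<dots> = (\<Sum>k<n. u k * v' k + v k * u' k) * f Y"
    by (simp add: sum_distrib_right)
  finally show ?thesis .
qed

lemma sum_flip:
  assumes "k < n"
  shows "(\<Sum>Y\<in>Pow {..<n}. h (flip Y k)) = (\<Sum>Y\<in>Pow {..<n}. h Y)"
  by (rule sum.reindex_bij_witness[where i = "\<lambda>Y. flip Y k" and j = "\<lambda>Y. flip Y k"])
     (use assms in auto)

text \<open>Substituting \<open>flip Y k\<close> for \<open>Y\<close> moves the flip to the other
  factor and exchanges the cases \<open>k \<in> Y\<close> and \<open>k \<notin> Y\<close>; the sign
  at \<open>k\<close> does not see the flip of \<open>k\<close> itself.\<close>

lemma clifford_adjoint: "ip n (clifford n u v f) g = ip n f (clifford n v u g)"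
proof -
  have "ip n (clifford n u v f) g
      = (\<Sum>k<n. \<Sum>Y\<in>Pow {..<n}. (if k \<in> Y then v k else u k) * sgn_below k Y * f (flip Y k) * g Y)"
    unfolding ip_def clifford_def sum_distrib_right by (rule sum.swap)
  also have "\<dots> = (\<Sum>k<n. \<Sum>Y\<in>Pow {..<n}.
      (if k \<in> flip Y k then v k else u k) * sgn_below k (flip Y k) * f (flip (flip Y k) k) * g (flip Y k))"
    by (intro sum.cong refl sum_flip[symmetric,
          where h = "\<lambda>Y. (if _ \<in> Y then _ else _) * sgn_below _ Y * f (flip Y _) * g Y"]) simp
  also have "\<dots> = (\<Sum>k<n. \<Sum>Y\<in>Pow {..<n}.
      f Y * ((if k \<in> Y then u k else v k) * sgn_below k Y * g (flip Y k)))"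
    unfolding flip_flip by (intro sum.cong refl) (simp add: sgn_below_flip)
  also have "\<dots> = ip n f (clifford n v u g)"
    unfolding ip_def clifford_def sum_distrib_left by (rule sum.swap)
  finally show ?thesis .
qed

lemma ip_nonneg: "0 \<le> ip n f f"
  by (simp add: ip_def sum_nonneg)

lemma ip_uminus: "ip n (\<lambda>Y. - f Y) (\<lambda>Y. - g Y) = ip n f g"
  by (simp add: ip_def)

lemma clifford_diff: "clifford n u v (\<lambda>Y. f Y - c * g Y) Y = clifford n u v f Y - c * clifford n u v g Y"
  by (simp add: clifford_def sum_subtractf sum_distrib_left algebra_simps)

lemma clifford_scale: "clifford n u v (\<lambda>Y. c * g Y) Y = c * clifford n u v g Y"
  by (simp add: clifford_def sum_distrib_left algebra_simps)

lemma clifford_sum_coeff: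
  "clifford n (\<lambda>k. \<Sum>j<m. c j * u j k) (\<lambda>k. \<Sum>j<m. c j * v j k) f Y
    = (\<Sum>j<m. c j * clifford n (u j) (v j) f Y)"
proof -
  have "clifford n (\<lambda>k. \<Sum>j<m. c j * u j k) (\<lambda>k. \<Sum>j<m. c j * v j k) f Y
      = (\<Sum>k<n. \<Sum>j<m. c j * ((if k \<in> Y then v j k else u j k) * sgn_below k Y * f (flip Y k)))"
    unfolding clifford_def by (intro sum.cong refl) (simp add: sum_distrib_right mult.assoc)
  also have "\<dots> = (\<Sum>j<m. c j * clifford n (u j) (v j) f Y)"
    unfolding clifford_def sum_distrib_left by (rule sum.swap)
  finally show ?thesis .
qed

lemma clifford_cong:
  assumes "\<And>k. k < n \<Longrightarrow> u k = u' k" "\<And>k. k < n \<Longrightarrow> v k = v' k"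
    and "\<And>k. k < n \<Longrightarrow> f (flip Y k) = f' (flip Y k)"
  shows "clifford n u v f Y = clifford n u' v' f' Y"
  unfolding clifford_def using assms by (intro sum.cong) auto

subsection \<open>Pfaffians\<close>

text \<open>In operator form, \<open>\<psi>\<^sub>n\<^sub>+\<^sub>1 = \<psi>\<^sub>n + a\<^sub>n* V \<psi>\<^sub>n\<close> with \<open>V = \<Sum>\<^sub>k a\<^sub>n\<^sub>k a\<^sub>k*\<close>.\<close>

fun pfaffian :: "(nat \<Rightarrow> nat \<Rightarrow> real) \<Rightarrow> nat \<Rightarrow> nat set \<Rightarrow> real" where
  "pfaffian a 0 S = (if S = {} then 1 else 0)"
| "pfaffian a (Suc n) S =
    (if n \<in> S then sgn_below n S * clifford n (\<lambda>_. 0) (a n) (pfaffian a n) (flip S n) else pfaffian a n S)"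

declare pfaffian.simps(2) [simp del]

lemma pfaffian_Suc_in:
  "n \<in> S \<Longrightarrow> pfaffian a (Suc n) S = sgn_below n S * clifford n (\<lambda>_. 0) (a n) (pfaffian a n) (flip S n)"
  by (simp add: pfaffian.simps(2))

lemma pfaffian_Suc_notin: "n \<notin> S \<Longrightarrow> pfaffian a (Suc n) S = pfaffian a n S"
  by (simp add: pfaffian.simps(2))

lemma pfaffian_empty: "pfaffian a n {} = 1"
  by (induction n) (auto simp: pfaffian_Suc_notin)

lemma card_flip_parity:
  assumes "finite S"
  shows "even (card (flip S k)) \<longleftrightarrow> odd (card S)"
proof (cases "k \<in> S")
  case True
  then have "flip S k = S - {k}" by (auto simp: flip_def)
  then show ?thesis
    using True assms by (metis card.remove even_Suc)
next
  case False
  then have "flip S k = insert k S" by (auto simp: flip_def)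
  then show ?thesis
    using False assms by simp
qed

lemma pfaffian_odd:
  assumes "finite S" "odd (card S)"
  shows "pfaffian a n S = 0"
  using assms
proof (induction n arbitrary: S)
  case (Suc n)
  have "pfaffian a n (flip (flip S n) k) = 0" for k
    using Suc.prems by (intro Suc.IH) (simp_all add: card_flip_parity)
  then show ?case
    using Suc by (simp add: clifford_def pfaffian.simps(2))
qed auto

section \<open>Vacuum relations of the Pfaffian vector\<close>

lemma clifford_pfaffian_Suc:
  assumes "n \<in> Y"
  shows "clifford n u v (pfaffian a (Suc n)) Y
    = - sgn_below n Y * clifford n u v (clifford n (\<lambda>_. 0) (a n) (pfaffian a n)) (flip Y n)"
  unfolding clifford_def[of n u v] sum_distrib_left
proof (intro sum.cong refl)
  fix k assume "k \<in> {..<n}"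
  then have k: "k < n" by simp
  have "pfaffian a (Suc n) (flip Y k)
      = sgn_below n (flip Y k) * clifford n (\<lambda>_. 0) (a n) (pfaffian a n) (flip (flip Y k) n)"
    using k assms by (subst pfaffian_Suc_in) auto
  \<comment> \<open>As \<open>k < n\<close>, the flip changes the sign at \<open>n\<close>: an
    operator on the lower modes anticommutes with the creator of mode \<open>n\<close>.\<close>
  moreover have "sgn_below n (flip Y k) = - sgn_below n Y"
    "sgn_below k (flip Y n) = sgn_below k Y"
    using k by (simp_all add: sgn_below_flip)
  moreover have "k \<in> flip Y n \<longleftrightarrow> k \<in> Y"
    using k by auto
  ultimately show "(if k \<in> Y then v k else u k) * sgn_below k Y * pfaffian a (Suc n) (flip Y k)
     = - sgn_below n Y * ((if k \<in> flip Y n then v k else u k) * sgn_below k (flip Y n)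
        * clifford n (\<lambda>_. 0) (a n) (pfaffian a n) (flip (flip Y n) k))"
    by (simp add: flip_commute[of Y k n])
qed

lemma clifford_Suc:
  "clifford (Suc n) u v f Y
    = clifford n u v f Y + (if n \<in> Y then v n else u n) * sgn_below n Y * f (flip Y n)"
  by (simp add: clifford_def)

lemma clifford_pfaffian_Suc_notin:
  assumes "n \<notin> Y"
  shows "clifford n u v (pfaffian a (Suc n)) Y = clifford n u v (pfaffian a n) Y"
  using assms by (intro clifford_cong) (auto simp: pfaffian_Suc_notin)

lemma sum_of_bool_mult:
  assumes "j < (n::nat)"
  shows "(\<Sum>k<n. of_bool (k = j) * h k) = (h j :: real)"
proof -
  have "(\<Sum>k<n. of_bool (k = j) * h k) = (\<Sum>k<n. if k = j then h k else 0)"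
    by (intro sum.cong) auto
  then show ?thesis using assms by simp
qed

text \<open>Induction on \<open>n\<close>. For the new index, annihilating the freshly created mode
  gives \<open>?V\<close>, which cancels the creator part. For \<open>j < n\<close>, moving the
  relation past \<open>?V\<close> leaves the scalar \<open>a n j\<close>, which cancels the
  contribution of the new entry by skew-symmetry.\<close>

lemma pfaffian_annihilated:
  assumes skew: "\<And>i j. a i j = - a j i" and "j < n"
  shows "clifford n (\<lambda>k. of_bool (k = j)) (\<lambda>k. - a j k) (pfaffian a n) Y = 0"
  using \<open>j < n\<close>
proof (induction n arbitrary: j Y)
  case (Suc n)
  let ?u = "\<lambda>k. of_bool (k = j)" and ?v = "\<lambda>k. - a j k"
  let ?V = "clifford n (\<lambda>_. 0) (a n) (pfaffian a n)"
  have nn: "a n n = 0" using skew[of n n] by simp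
  show ?case
  proof (cases "j = n")
    case True
    show ?thesis
    proof (cases "n \<in> Y")
      case False
      have "pfaffian a (Suc n) (flip Y n) = sgn_below n (flip Y n) * ?V (flip (flip Y n) n)"
        using False by (subst pfaffian_Suc_in) auto
      then have "pfaffian a (Suc n) (flip Y n) = sgn_below n Y * ?V Y"
        unfolding flip_flip by (simp add: sgn_below_flip)
      then have "clifford (Suc n) ?u ?v (pfaffian a (Suc n)) Y
          = clifford n ?u ?v (pfaffian a n) Y + (sgn_below n Y * sgn_below n Y) * ?V Y"
        using False True unfolding clifford_Suc clifford_pfaffian_Suc_notin[OF False] by simp
      moreover have "clifford n ?u ?v (pfaffian a n) Y = - ?V Y"
        using True by (simp add: clifford_def flip: sum_negf) (intro sum.cong; auto)
      ultimately show ?thesis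
        by (simp add: sgn_below_squared)
    next
      case True
      have "clifford n ?u ?v ?V (flip Y n) = clifford n (\<lambda>_. 0) (\<lambda>k. - a n k) ?V (flip Y n)"
        using \<open>j = n\<close> by (intro clifford_cong) auto
      also have "\<dots> = - clifford n (\<lambda>_. 0) (a n) ?V (flip Y n)"
        by (simp add: clifford_def flip: sum_negf) (intro sum.cong; auto)
      \<comment> \<open>\<open>?V\<close> applies creators only, so its anticommutator with itself
        vanishes.\<close>
      also have "clifford n (\<lambda>_. 0) (a n) ?V (flip Y n) = 0"
        using clifford_anticommutator[of n "\<lambda>_. 0" "a n" "\<lambda>_. 0" "a n" "pfaffian a n" "flip Y n"] by simp
      finally show ?thesis
        using True \<open>j = n\<close> nn unfolding clifford_Suc clifford_pfaffian_Suc[OF True] by simp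
    qed
  next
    case False
    then have j: "j < n" using Suc.prems by simp
    note IH = Suc.IH[OF j]
    show ?thesis
    proof (cases "n \<in> Y")
      case False
      then show ?thesis
        using \<open>j \<noteq> n\<close> IH unfolding clifford_Suc clifford_pfaffian_Suc_notin[OF False] by simp
    next
      case True
      have "clifford n ?u ?v (pfaffian a n) = (\<lambda>_. 0)"
        using IH by auto
      then have "clifford n (\<lambda>_. 0) (a n) (clifford n ?u ?v (pfaffian a n)) (flip Y n) = 0"
        by (simp add: clifford_def)
      then have "clifford n ?u ?v ?V (flip Y n) = a n j * pfaffian a n (flip Y n)"
        using clifford_anticommutator[of n ?u ?v "\<lambda>_. 0" "a n" "pfaffian a n" "flip Y n"] j
        by (simp add: sum_of_bool_mult)
      moreover have "pfaffian a (Suc n) (flip Y n) = pfaffian a n (flip Y n)"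
        using True by (simp add: pfaffian_Suc_notin)
      ultimately show ?thesis
        using True skew[of j n] unfolding clifford_Suc clifford_pfaffian_Suc[OF True] by simp
    qed
  qed
qed simp

text \<open>After subtracting the right multiple of the Pfaffian the remainder \<open>\<eta>\<close>
  vanishes at the empty set. The relation for \<open>j \<in> S\<close>, read at
  \<open>S - {j}\<close>, expresses \<open>\<eta> S\<close> through values at proper subsets, so
  induction on cardinality applies.\<close>

lemma vacuum_unique:
  assumes skew: "\<And>i j. a i j = - a j i"
    and vac: "\<And>j Y. j < n \<Longrightarrow> Y \<subseteq> {..<n} \<Longrightarrow>
      clifford n (\<lambda>k. of_bool (k = j)) (\<lambda>k. - a j k) \<theta> Y = 0"
    and "S \<subseteq> {..<n}"
  shows "\<theta> S = \<theta> {} * pfaffian a n S"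
proof -
  define \<eta> where "\<eta> S = \<theta> S - \<theta> {} * pfaffian a n S" for S
  have vac': "clifford n (\<lambda>k. of_bool (k = j)) (\<lambda>k. - a j k) \<eta> Y = 0" if "j < n" "Y \<subseteq> {..<n}" for j Y
    unfolding \<eta>_def clifford_diff using vac[OF that] pfaffian_annihilated[where a = a and Y = Y, OF skew that(1)]
    by (simp only: mult_zero_right diff_zero)
  have "\<eta> S = 0"
    using \<open>S \<subseteq> {..<n}\<close>
  proof (induction "card S" arbitrary: S rule: less_induct)
    case less
    show ?case
    proof (cases "S = {}")
      case True
      then show ?thesis by (simp add: \<eta>_def pfaffian_empty)
    next
      case False
      then obtain j where j: "j \<in> S" by auto
      have fin: "finite S" using less.prems finite_subset by blast
      define Y where "Y = S - {j}"
      have jn: "j < n" and Yn: "Y \<subseteq> {..<n}" using less.prems j by (auto simp: Y_def)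
      have "(if k \<in> Y then - a j k else of_bool (k = j)) * sgn_below k Y * \<eta> (flip Y k)
          = (if k = j then sgn_below j Y * \<eta> S else 0)" if "k < n" for k
      proof (cases "k \<in> Y")
        case True
        then have "flip Y k \<subset> S" by (auto simp: Y_def)
        then have "card (flip Y k) < card S" using fin by (intro psubset_card_mono)
        then have "\<eta> (flip Y k) = 0"
          using less.hyps \<open>flip Y k \<subset> S\<close> less.prems by (meson order.trans psubset_imp_subset)
        moreover have "k \<noteq> j" using True by (auto simp: Y_def)
        ultimately show ?thesis by simp
      next
        case False
        have "flip Y j = S" using j by (auto simp: Y_def)
        then show ?thesis using False by simp
      qed
      then have "0 = sgn_below j Y * \<eta> S"
        using vac'[OF jn Yn] jn by (simp add: clifford_def)
      then show ?thesis
        using sgn_below_squared[of j Y] by auto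
    qed
  qed
  then show ?thesis by (simp add: \<eta>_def)
qed

section \<open>The norm of the Pfaffian vector as a determinant\<close>

definition one_plus :: "(nat \<Rightarrow> nat \<Rightarrow> real) \<Rightarrow> nat \<Rightarrow> real mat" where
  "one_plus a n = mat n n (\<lambda>(i,j). of_bool (i = j) + a i j)"

lemma one_plus_carrier [simp]: "one_plus a n \<in> carrier_mat n n"
  by (simp add: one_plus_def)

text \<open>Column elimination: right multiplication by the unipotent matrix \<open>C\<close> adds
  \<open>r\<close>-multiples of the first \<open>n\<close> columns to the last one and clears it
  above the corner, where a Schur complement remains.\<close>

lemma det_one_plus_Suc:
  assumes r: "\<And>i. i < n \<Longrightarrow> r i + (\<Sum>j<n. a i j * r j) = - a i n" and "a n n = 0"
  shows "det (one_plus a (Suc n)) = det (one_plus a n) * (1 + (\<Sum>j<n. a n j * r j))"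
proof -
  define C where "C = mat (Suc n) (Suc n) (\<lambda>(i,j). of_bool (i = j) + (if j = n \<and> i < n then r i else 0))"
  define D where "D = four_block_mat (one_plus a n) (0\<^sub>m n 1) (mat 1 n (\<lambda>(i,j). a n j))
      (mat 1 1 (\<lambda>_. 1 + (\<Sum>j<n. a n j * r j)))"
  have C: "C \<in> carrier_mat (Suc n) (Suc n)" by (simp add: C_def)
  have "upper_triangular C"
    by (auto simp: C_def)
  then have "det C = 1"
    using det_upper_triangular[OF _ C] unfolding prod_list_diag_prod by (simp add: C_def)
  have "one_plus a (Suc n) * C = D"
  proof (rule eq_matI)
    fix i j assume "i < dim_row D" "j < dim_col D"
    then have i: "i < Suc n" and j: "j < Suc n"
      by (simp_all add: D_def one_plus_def)
    have "(one_plus a (Suc n) * C) $$ (i,j) = (\<Sum>k<Suc n. (of_bool (i = k) + a i k) *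
        (of_bool (k = j) + (if j = n \<and> k < n then r k else 0)))"
      using i j by (simp add: one_plus_def C_def scalar_prod_def atLeast0LessThan)
    also have "\<dots> = (if j < n then of_bool (i = j) + a i j
        else (\<Sum>k<n. (of_bool (i = k) + a i k) * r k) + of_bool (i = n) + a i n)"
    proof (cases "j < n")
      case True
      have "(\<Sum>k<Suc n. (of_bool (i = k) + a i k) *
        (of_bool (k = j) + (if j = n \<and> k < n then r k else 0)))
        = (\<Sum>k<Suc n. of_bool (k = j) * (of_bool (i = k) + a i k))"
        using True by (intro sum.cong) auto
      then show ?thesis
        using True j by (simp only: sum_of_bool_mult) simp
    next
      case False
      then have "j = n" using j by simp
      then show ?thesis by simp
    qed
    also have "\<dots> = D $$ (i,j)"
    proof (cases "j < n")
      case True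
      then show ?thesis using i by (auto simp: D_def one_plus_def less_Suc_eq)
    next
      case False
      then have "j = n" using j by simp
      have "(\<Sum>k<n. (of_bool (i = k) + a i k) * r k)
          = (\<Sum>k<n. of_bool (k = i) * r k) + (\<Sum>k<n. a i k * r k)"
        unfolding sum.distrib[symmetric] by (intro sum.cong) (auto simp: algebra_simps)
      moreover have "(\<Sum>k<n. of_bool (k = i) * r k) = (if i < n then r i else 0)"
        by (cases "i < n") (auto simp: sum_of_bool_mult intro!: sum.neutral)
      ultimately show ?thesis
        using i \<open>j = n\<close> r[of i] assms(2)
        by (auto simp: D_def one_plus_def less_Suc_eq)
    qed
    finally show "(one_plus a (Suc n) * C) $$ (i,j) = D $$ (i,j)" .
  qed (simp_all add: D_def one_plus_def C_def)
  then have "det (one_plus a (Suc n)) * det C = det D"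
    using C by (metis det_mult one_plus_carrier)
  also have "det D = det (one_plus a n) * (1 + (\<Sum>j<n. a n j * r j))"
    unfolding D_def
    by (subst det_four_block_mat_upper_right_zero[of _ n _ 1]) (auto simp: det_single)
  finally show ?thesis
    using \<open>det C = 1\<close> by simp
qed

lemma ip_Suc:
  "ip (Suc n) f g = ip n f g + (\<Sum>Y\<in>Pow {..<n}. f (flip Y n) * g (flip Y n))"
proof -
  have "Pow {..<Suc n} = Pow {..<n} \<union> insert n ` Pow {..<n}"
    by (simp add: lessThan_Suc Pow_insert)
  also have "insert n ` Pow {..<n} = (\<lambda>Y. flip Y n) ` Pow {..<n}"
    by (intro image_cong) (auto simp: flip_def)
  finally have split: "Pow {..<Suc n} = Pow {..<n} \<union> (\<lambda>Y. flip Y n) ` Pow {..<n}" .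
  have "Pow {..<n} \<inter> (\<lambda>Y. flip Y n) ` Pow {..<n} = {}"
    by (auto simp: flip_def)
  moreover have "inj_on (\<lambda>Y. flip Y n) (Pow {..<n})"
    by (rule inj_on_inverseI[where g = "\<lambda>Y. flip Y n"]) simp
  ultimately show ?thesis
    unfolding ip_def split by (simp add: sum.union_disjoint sum.reindex)
qed

lemma ip_pfaffian_Suc:
  "ip (Suc n) (pfaffian a (Suc n)) (pfaffian a (Suc n)) = ip n (pfaffian a n) (pfaffian a n)
    + ip n (clifford n (\<lambda>_. 0) (a n) (pfaffian a n)) (clifford n (\<lambda>_. 0) (a n) (pfaffian a n))"
proof -
  let ?V = "clifford n (\<lambda>_. 0) (a n) (pfaffian a n)"
  have "pfaffian a (Suc n) (flip Y n) * pfaffian a (Suc n) (flip Y n) = ?V Y * ?V Y"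
    and "pfaffian a (Suc n) Y = pfaffian a n Y" if "Y \<in> Pow {..<n}" for Y
  proof -
    have Y: "n \<notin> Y" using that by auto
    then have "pfaffian a (Suc n) (flip Y n) * pfaffian a (Suc n) (flip Y n)
        = (sgn_below n (flip Y n) * sgn_below n (flip Y n)) * (?V Y * ?V Y)"
      by (simp add: pfaffian_Suc_in)
    then show "pfaffian a (Suc n) (flip Y n) * pfaffian a (Suc n) (flip Y n) = ?V Y * ?V Y"
      by (simp add: sgn_below_squared)
    show "pfaffian a (Suc n) Y = pfaffian a n Y"
      using Y by (rule pfaffian_Suc_notin)
  qed
  then show ?thesis
    unfolding ip_Suc by (simp add: ip_def)
qed

text \<open>The operator is minus its own adjoint, and by the anticommutator formula its square is a
  nonpositive scalar; it is therefore a multiple of an isometry.\<close>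

lemma ip_clifford_antisymmetric:
  "ip n (clifford n (\<lambda>k. - r k) r f) (clifford n (\<lambda>k. - r k) r f) = (\<Sum>k<n. (r k)\<^sup>2) * ip n f f"
proof -
  let ?G = "clifford n (\<lambda>k. - r k) r"
  have "(\<Sum>k<n. - r k * r k + r k * - r k) = - 2 * (\<Sum>k<n. (r k)\<^sup>2)"
    unfolding sum_distrib_left by (intro sum.cong) (auto simp: power2_eq_square)
  then have "?G (?G f) Y + ?G (?G f) Y = (- 2 * (\<Sum>k<n. (r k)\<^sup>2)) * f Y" for Y
    unfolding clifford_anticommutator[of n "\<lambda>k. - r k" r "\<lambda>k. - r k" r f] by (rule arg_cong)
  moreover have "x = - c * y" if "x + x = (- 2 * c) * y" for x c y :: real
    using that by (simp add: algebra_simps)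
  ultimately have "?G (?G f) Y = - (\<Sum>k<n. (r k)\<^sup>2) * f Y" for Y
    by blast
  moreover have "clifford n r (\<lambda>k. - r k) (?G f) = (\<lambda>Y. - ?G (?G f) Y)"
    unfolding clifford_def[of n r] clifford_def[of n "\<lambda>k. - r k" r "?G f"]
    by (auto simp: sum_negf[symmetric] intro!: sum.cong)
  ultimately have "clifford n r (\<lambda>k. - r k) (?G f) = (\<lambda>Y. (\<Sum>k<n. (r k)\<^sup>2) * f Y)"
    by auto
  then show ?thesis
    unfolding clifford_adjoint by (simp add: ip_def sum_distrib_left algebra_simps)
qed

lemma solve_nonsingular:
  assumes "M \<in> carrier_mat n n" "det (M :: real mat) \<noteq> 0"
  obtains r where "\<And>i. i < n \<Longrightarrow> (\<Sum>j<n. M $$ (i,j) * r j) = w i"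
proof -
  from det_non_zero_imp_unit[OF assms] obtain B where B: "B \<in> carrier_mat n n" "M * B = 1\<^sub>m n"
    by (auto simp: Units_def ring_mat_simps)
  define x where "x = B *\<^sub>v vec n w"
  have x: "x \<in> carrier_vec n" using B by (simp add: x_def)
  have "M *\<^sub>v x = vec n w"
    unfolding x_def using assms B by (subst assoc_mult_mat_vec[symmetric]) auto
  then have "(\<Sum>j<n. M $$ (i,j) * x $ j) = w i" if "i < n" for i
    using that assms(1) x
    by (metis (no_types, lifting) carrier_matD carrier_vecD atLeast0LessThan index_mult_mat_vec
        index_row(1) index_vec lessThan_iff scalar_prod_def sum.cong)
  then show ?thesis using that by blast
qed

lemma norm_pfaffian_pos: "0 < ip n (pfaffian a n) (pfaffian a n)"
proof -
  have "pfaffian a n {} * pfaffian a n {} \<le> ip n (pfaffian a n) (pfaffian a n)"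
    unfolding ip_def by (intro member_le_sum) auto
  then show ?thesis by (simp add: pfaffian_empty)
qed

text \<open>
  If \<open>(1 + A) r\<close> is the new row, then \<open>V \<psi> = \<Sum>\<^sub>k r\<^sub>k (a\<^sub>k* - a\<^sub>k) \<psi>\<close> by the vacuum relations, so
  bordering multiplies both sides by \<open>1 + \<bar>r\<bar>\<^sup>2\<close>.
\<close>

lemma norm_pfaffian_eq_det:
  assumes skew: "\<And>i j. a i j = - a j i"
  shows "ip n (pfaffian a n) (pfaffian a n) = det (one_plus a n)"
proof (induction n)
  case 0
  have "one_plus a 0 = 1\<^sub>m 0" by (auto simp: one_plus_def)
  then show ?case by (simp add: ip_def)
next
  case (Suc n)
  let ?\<psi> = "pfaffian a n"
  \<comment> \<open>By the induction hypothesis this determinant is a squared norm, to which the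
    empty set alone contributes 1.\<close>
  have "det (one_plus a n) \<noteq> 0"
    using norm_pfaffian_pos[of n a] Suc.IH by simp
  from solve_nonsingular[OF one_plus_carrier this, where w = "a n"] obtain r
    where r0: "\<And>i. i < n \<Longrightarrow> (\<Sum>j<n. one_plus a n $$ (i,j) * r j) = a n i"
    by blast
  have r: "r i + (\<Sum>j<n. a i j * r j) = a n i" if "i < n" for i
  proof -
    have "(\<Sum>j<n. one_plus a n $$ (i,j) * r j) = (\<Sum>j<n. of_bool (j = i) * r j + a i j * r j)"
      using that by (intro sum.cong) (auto simp: one_plus_def distrib_right)
    then show ?thesis
      using r0[OF that] that by (simp add: sum.distrib sum_of_bool_mult)
  qed
  have "a n n = 0" using skew[of n n] by simp
  have det: "det (one_plus a (Suc n)) = det (one_plus a n) * (1 + (\<Sum>j<n. a n j * r j))"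
  proof (rule det_one_plus_Suc)
    fix i assume "i < n"
    then show "r i + (\<Sum>j<n. a i j * r j) = - a i n"
      using r[of i] skew[of n i] by linarith
  qed fact
  \<comment> \<open>Pairing \<open>(1 + A) r\<close> with \<open>r\<close> leaves only the squared
    length, because the quadratic form of a skew matrix vanishes.\<close>
  have "(\<Sum>i<n. a n i * r i) = (\<Sum>i<n. (r i)\<^sup>2) + (\<Sum>i<n. \<Sum>j<n. a i j * r j * r i)"
  proof -
    have "(\<Sum>i<n. a n i * r i) = (\<Sum>i<n. (r i + (\<Sum>j<n. a i j * r j)) * r i)"
      using r by (intro sum.cong) auto
    then show ?thesis
      by (simp add: algebra_simps sum.distrib power2_eq_square sum_distrib_right sum_distrib_left)
  qed
  moreover have "(\<Sum>i<n. \<Sum>j<n. a i j * r j * r i) = 0"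
  proof -
    have "(\<Sum>i<n. \<Sum>j<n. a i j * r j * r i) = (\<Sum>j<n. \<Sum>i<n. a i j * r j * r i)"
      by (rule sum.swap)
    also have "\<dots> = (\<Sum>j<n. \<Sum>i<n. - (a j i * r i * r j))"
      using skew by (intro sum.cong refl) (metis minus_mult_left mult.assoc mult.commute)
    also have "\<dots> = - (\<Sum>i<n. \<Sum>j<n. a i j * r j * r i)"
      by (simp add: sum_negf)
    finally show ?thesis by simp
  qed
  ultimately have vr: "(\<Sum>i<n. a n i * r i) = (\<Sum>i<n. (r i)\<^sup>2)" by simp
  have V: "clifford n (\<lambda>_. 0) (a n) ?\<psi> = clifford n (\<lambda>k. - r k) r ?\<psi>"
  proof
    fix Y
    \<comment> \<open>The vacuum relations are combined with weights \<open>r j\<close>; by the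
      choice of \<open>r\<close>, the creator coefficients of the result are the new row minus
      \<open>r\<close>.\<close>
    have "clifford n (\<lambda>k. \<Sum>j<n. r j * of_bool (k = j)) (\<lambda>k. \<Sum>j<n. r j * - a j k) ?\<psi> Y = 0"
      unfolding clifford_sum_coeff using pfaffian_annihilated[of a, OF skew] by (intro sum.neutral) auto
    moreover have "clifford n (\<lambda>k. \<Sum>j<n. r j * of_bool (k = j)) (\<lambda>k. \<Sum>j<n. r j * - a j k) ?\<psi> Y
        = clifford n r (\<lambda>k. a n k - r k) ?\<psi> Y"
    proof (rule clifford_cong)
      fix k assume k: "k < n"
      have "(\<Sum>j<n. r j * of_bool (k = j)) = (\<Sum>j<n. of_bool (j = k) * r j)"
        by (intro sum.cong) auto
      then show "(\<Sum>j<n. r j * of_bool (k = j)) = r k"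
        using k by (simp only: sum_of_bool_mult)
      have "(\<Sum>j<n. r j * - a j k) = (\<Sum>j<n. a k j * r j)"
        using skew by (intro sum.cong refl) (metis mult.commute)
      then show "(\<Sum>j<n. r j * - a j k) = a n k - r k"
        using r[OF k] by simp
    qed simp
    moreover have "clifford n (\<lambda>_. 0) (a n) ?\<psi> Y
        = clifford n (\<lambda>k. - r k) r ?\<psi> Y + clifford n r (\<lambda>k. a n k - r k) ?\<psi> Y"
      unfolding clifford_def sum.distrib[symmetric] by (intro sum.cong) (auto simp: algebra_simps)
    ultimately show "clifford n (\<lambda>_. 0) (a n) ?\<psi> Y = clifford n (\<lambda>k. - r k) r ?\<psi> Y"
      by simp
  qed
  show ?case
    unfolding ip_pfaffian_Suc V ip_clifford_antisymmetric det vr Suc.IH[symmetric]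
    by (simp add: algebra_simps)
qed

subsection \<open>Principal minors\<close>

text \<open>The Leibniz formula over permutations of \<open>S\<close> itself, so that minors for
  different \<open>S\<close> can be compared without renumbering rows.\<close>

definition principal_minor :: "(nat \<Rightarrow> nat \<Rightarrow> real) \<Rightarrow> nat set \<Rightarrow> real" where
  "principal_minor a S = (\<Sum>p | p permutes S. of_int (sign p) * (\<Prod>i\<in>S. a i (p i)))"

lemma bij_betw_pick:
  assumes "finite S"
  shows "bij_betw (pick S) {0..<card S} S"
proof -
  have inj: "inj_on (pick S) {0..<card S}"
    by (rule linorder_inj_onI) (auto dest!: pick_mono_le[where S = S])
  moreover have "pick S ` {0..<card S} \<subseteq> S"
    by (auto intro: pick_in_set_le)
  moreover have "card (pick S ` {0..<card S}) = card S"
    using card_image[OF inj] by simp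
  ultimately show ?thesis
    using assms by (simp add: bij_betw_def card_subset_eq)
qed

lemma permutes_lessThan: "p permutes {0..<m} \<Longrightarrow> i < m \<Longrightarrow> p i < (m::nat)"
  using permutes_in_image[of p "{0..<m}" i] by simp

text \<open>The increasing enumeration \<open>pick S\<close> conjugates permutations of positions
  into permutations of \<open>S\<close>, which preserves signs.\<close>

lemma principal_minor_eq_det_submatrix:
  assumes A: "A \<in> carrier_mat n n" and S: "S \<subseteq> {..<n}"
  shows "principal_minor (\<lambda>i j. A $$ (i,j)) S = det (submatrix A S S)"
proof -
  define m where "m = card S"
  define f where "f = pick S"
  have fin: "finite S" using S finite_subset by blast
  have bij: "bij_betw f {0..<m} S"
    unfolding f_def m_def using fin by (rule bij_betw_pick)
  then have inj: "inj_on f {0..<m}" and img: "f ` {0..<m} = S"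
    by (auto simp: bij_betw_def)
  have "{i. i < n \<and> i \<in> S} = S" using S by auto
  then have sub: "submatrix A S S = mat m m (\<lambda>(i,j). A $$ (f i, f j))"
    using A by (simp add: submatrix_def m_def f_def)
  let ?g = "map_permutation {0..<m} f"
  have "det (submatrix A S S)
      = (\<Sum>p | p permutes {0..<m}. of_int (sign p) * (\<Prod>i=0..<m. A $$ (f i, f (p i))))"
    unfolding sub by (subst det_def'[of _ m]) (auto intro!: sum.cong prod.cong dest: permutes_lessThan)
  also have "\<dots> = (\<Sum>p | p permutes {0..<m}. of_int (sign (?g p)) * (\<Prod>i\<in>S. A $$ (i, ?g p i)))"
  proof (intro sum.cong refl, clarify)
    fix p assume p: "p permutes {0..<m}"
    have "(\<Prod>i\<in>S. A $$ (i, ?g p i)) = (\<Prod>i=0..<m. A $$ (f i, ?g p (f i)))"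
      unfolding img[symmetric] using inj by (simp add: prod.reindex)
    also have "\<dots> = (\<Prod>i=0..<m. A $$ (f i, f (p i)))"
    proof (intro prod.cong refl)
      fix i assume "i \<in> {0..<m}"
      then show "A $$ (f i, ?g p (f i)) = A $$ (f i, f (p i))"
        using inj by (auto simp: map_permutation_def restrict_id_def inv_into_f_f)
    qed
    finally show "of_int (sign p) * (\<Prod>i=0..<m. A $$ (f i, f (p i)))
        = of_int (sign (?g p)) * (\<Prod>i\<in>S. A $$ (i, ?g p i))"
      using sign_map_permutation[OF inj p] by simp
  qed
  also have "\<dots> = (\<Sum>p | p permutes S. of_int (sign p) * (\<Prod>i\<in>S. A $$ (i, p i)))"
  proof -
    have "?g = (\<lambda>p x. if x \<in> S then f (p (inv_into {0..<m} f x)) else x)"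
      by (auto simp: map_permutation_def restrict_id_def img fun_eq_iff)
    then have "bij_betw ?g {p. p permutes {0..<m}} {p. p permutes S}"
      using bij_betw_permutations[OF bij] by simp
    then show ?thesis
      by (rule sum.reindex_bij_betw)
  qed
  finally show ?thesis
    by (simp add: principal_minor_def)
qed

text \<open>Expand each product and let \<open>S\<close> be the rows whose factor comes from
  \<open>a\<close>. The other rows take identity entries, which force fixed points, so only
  permutations of \<open>S\<close> survive.\<close>

lemma det_identity_plus:
  "det (mat n n (\<lambda>(i,j). of_bool (i = j) + a i j)) = (\<Sum>S\<in>Pow {..<n}. principal_minor a S)"
proof -
  have "det (mat n n (\<lambda>(i,j). of_bool (i = j) + a i j))
      = (\<Sum>p | p permutes {..<n}. of_int (sign p) * (\<Prod>i<n. a i (p i) + of_bool (i = p i)))"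
    by (subst det_def'[of _ n])
      (auto intro!: sum.cong prod.cong dest: permutes_lessThan simp: atLeast0LessThan add.commute)
  also have "\<dots> = (\<Sum>p | p permutes {..<n}. \<Sum>S\<in>Pow {..<n}.
      of_int (sign p) * ((\<Prod>i\<in>S. a i (p i)) * (\<Prod>i\<in>{..<n} - S. of_bool (i = p i))))"
    by (simp add: prod_add sum_distrib_left)
  also have "\<dots> = (\<Sum>S\<in>Pow {..<n}. \<Sum>p | p permutes {..<n}.
      of_int (sign p) * ((\<Prod>i\<in>S. a i (p i)) * (\<Prod>i\<in>{..<n} - S. of_bool (i = p i))))"
    by (rule sum.swap)
  also have "\<dots> = (\<Sum>S\<in>Pow {..<n}. principal_minor a S)"
  proof (intro sum.cong refl)
    fix S assume S: "S \<in> Pow {..<n}"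
    have "(\<Sum>p | p permutes {..<n}.
        of_int (sign p) * ((\<Prod>i\<in>S. a i (p i)) * (\<Prod>i\<in>{..<n} - S. of_bool (i = p i))))
        = (\<Sum>p | p permutes S.
        of_int (sign p) * ((\<Prod>i\<in>S. a i (p i)) * (\<Prod>i\<in>{..<n} - S. of_bool (i = p i))))"
    proof (rule sum.mono_neutral_right)
      show "finite {p. p permutes {..<n}}" by (simp add: finite_permutations)
      show "{p. p permutes S} \<subseteq> {p. p permutes {..<n}}"
        using S by (auto intro: permutes_subset)
      show "\<forall>p\<in>{p. p permutes {..<n}} - {p. p permutes S}.
        of_int (sign p) * ((\<Prod>i\<in>S. a i (p i)) * (\<Prod>i\<in>{..<n} - S. of_bool (i = p i))) = 0"
      proof
        fix p assume p: "p \<in> {p. p permutes {..<n}} - {p. p permutes S}"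
        then have "\<exists>i\<in>{..<n} - S. i \<noteq> p i"
          using permutes_superset[of p "{..<n}" S] by force
        then show "of_int (sign p) * ((\<Prod>i\<in>S. a i (p i)) * (\<Prod>i\<in>{..<n} - S. of_bool (i = p i))) = 0"
          by (auto simp: prod_zero_iff)
      qed
    qed
    also have "\<dots> = principal_minor a S"
      unfolding principal_minor_def
      by (intro sum.cong refl) (auto simp: permutes_not_in intro!: prod.neutral)
    finally show "(\<Sum>p | p permutes {..<n}.
        of_int (sign p) * ((\<Prod>i\<in>S. a i (p i)) * (\<Prod>i\<in>{..<n} - S. of_bool (i = p i))))
        = principal_minor a S" .
  qed
  finally show ?thesis .
qed

text \<open>Entries are zeroed rather than removed: the index range stays \<open>{..<n}\<close>, so
  the determinant identities apply unchanged to a subset.\<close>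

definition restr :: "(nat \<Rightarrow> nat \<Rightarrow> real) \<Rightarrow> nat set \<Rightarrow> nat \<Rightarrow> nat \<Rightarrow> real" where
  "restr a T i j = (if i \<in> T \<and> j \<in> T then a i j else 0)"

lemma pfaffian_restr: "pfaffian (restr a T) m S = (if S \<subseteq> T then pfaffian a m S else 0)"
proof (induction m arbitrary: S)
  case (Suc m)
  show ?case
  proof (cases "m \<in> S")
    case False
    then show ?thesis using Suc.IH by (simp add: pfaffian_Suc_notin)
  next
    case True
    let ?S = "flip S m"
    have "(if k \<in> ?S then restr a T m k else 0) * sgn_below k ?S * pfaffian (restr a T) m (flip ?S k)
        = (if S \<subseteq> T then (if k \<in> ?S then a m k else 0) * sgn_below k ?S * pfaffian a m (flip ?S k) else 0)"
      for k
    proof (cases "k \<in> ?S \<and> m \<in> T \<and> k \<in> T")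
      case True
      then have "flip ?S k \<subseteq> T \<longleftrightarrow> S \<subseteq> T"
        using \<open>m \<in> S\<close> by (auto simp: flip_def)
      then show ?thesis
        using True by (simp add: restr_def Suc.IH)
    next
      case False
      then show ?thesis
        using \<open>m \<in> S\<close> by (auto simp: restr_def)
    qed
    then have "clifford m (\<lambda>_. 0) (restr a T m) (pfaffian (restr a T) m) ?S
        = (if S \<subseteq> T then clifford m (\<lambda>_. 0) (a m) (pfaffian a m) ?S else 0)"
      unfolding clifford_def by (simp only:) simp
    then show ?thesis
      using True by (simp add: pfaffian_Suc_in)
  qed
qed auto

lemma principal_minor_restr:
  assumes "finite S"
  shows "principal_minor (restr a T) S = (if S \<subseteq> T then principal_minor a S else 0)"
proof (cases "S \<subseteq> T")
  case True
  have "restr a T i (p i) = a i (p i)" if "p permutes S" "i \<in> S" for p i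
    using True that permutes_in_image[OF that(1), of i] by (auto simp: restr_def)
  then show ?thesis
    using True by (auto simp: principal_minor_def intro!: sum.cong prod.cong)
next
  case False
  then obtain i where "i \<in> S" "i \<notin> T" by auto
  then have "(\<Prod>i\<in>S. restr a T i (p i)) = 0" for p
    using assms by (auto simp: restr_def)
  then show ?thesis
    using False by (simp add: principal_minor_def)
qed

text \<open>
  Only sums over all subsets of a set are compared directly; the individual terms are then recovered
  by induction on the set.
\<close>

lemma principal_minor_eq_pfaffian_squared:
  assumes skew: "\<And>i j. a i j = - a j i" and "S \<subseteq> {..<n}"
  shows "principal_minor a S = (pfaffian a n S)\<^sup>2"
  using \<open>S \<subseteq> {..<n}\<close>
proof (induction "card S" arbitrary: S rule: less_induct)
  case less
  have fin: "finite S" using less.prems finite_subset by blast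
  have restrict: "(\<Sum>T\<in>Pow {..<n}. if T \<subseteq> S then h T else 0) = (\<Sum>T\<in>Pow S. h T)"
    for h :: "nat set \<Rightarrow> real"
    using less.prems by (intro sum.mono_neutral_cong_right) auto
  \<comment> \<open>For the array restricted to \<open>S\<close>, the norm identity and the
    expansion of \<open>det (1 + A)\<close> become sums over subsets of \<open>S\<close>
    only.\<close>
  have "(\<Sum>T\<in>Pow S. (pfaffian a n T)\<^sup>2) = ip n (pfaffian (restr a S) n) (pfaffian (restr a S) n)"
    unfolding ip_def restrict[symmetric] by (intro sum.cong) (auto simp: pfaffian_restr power2_eq_square)
  also have "\<dots> = det (one_plus (restr a S) n)"
  proof (rule norm_pfaffian_eq_det)
    show "restr a S i j = - restr a S j i" for i j
      using skew[of i j] by (simp add: restr_def)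
  qed
  also have "\<dots> = (\<Sum>T\<in>Pow {..<n}. principal_minor (restr a S) T)"
    unfolding one_plus_def by (rule det_identity_plus)
  also have "\<dots> = (\<Sum>T\<in>Pow S. principal_minor a T)"
    unfolding restrict[symmetric]
    by (intro sum.cong) (auto simp: principal_minor_restr finite_subset[OF _ finite_lessThan])
  finally have "(\<Sum>T\<in>Pow S. principal_minor a T) = (\<Sum>T\<in>Pow S. (pfaffian a n T)\<^sup>2)" ..
  moreover have "(\<Sum>T\<in>Pow S - {S}. principal_minor a T) = (\<Sum>T\<in>Pow S - {S}. (pfaffian a n T)\<^sup>2)"
  proof (intro sum.cong refl)
    fix T assume T: "T \<in> Pow S - {S}"
    then have "card T < card S" using fin by (intro psubset_card_mono) auto
    then show "principal_minor a T = (pfaffian a n T)\<^sup>2"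
      using T less by auto
  qed
  ultimately show ?case
    using fin by (simp add: sum.remove[of "Pow S" S])
qed

section \<open>Weights of a skew-symmetric matrix as squared Pfaffians\<close>

definition entries :: "real mat \<Rightarrow> nat \<Rightarrow> nat \<Rightarrow> real" where
  "entries A = restr (\<lambda>i j. A $$ (i,j)) {..<dim_row A}"

text \<open>Extension by zero makes skew-symmetry hold at all pairs of naturals, the form in which
  the Pfaffian lemmas assume it.\<close>

lemma entries_skew:
  assumes "A \<in> carrier_mat n n" "transpose_mat A = - A"
  shows "entries A i j = - entries A j i"
proof (cases "i < n \<and> j < n")
  case True
  have "transpose_mat A $$ (i,j) = (- A) $$ (i,j)"
    using assms(2) by simp
  then have "A $$ (j,i) = - A $$ (i,j)"
    using True assms(1) by simp
  then show ?thesis by (simp add: entries_def restr_def)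
next
  case False
  then show ?thesis
    using assms(1) by (auto simp: entries_def restr_def)
qed

text \<open>Cayley's identity between determinants and Pfaffians; nonnegativity of the weights comes
  from here.\<close>

lemma weight_eq_pfaffian_squared:
  assumes "A \<in> carrier_mat n n" "transpose_mat A = - A" "S \<subseteq> {..<n}"
  shows "weight A S = (pfaffian (entries A) n S)\<^sup>2"
proof -
  have "weight A S = principal_minor (\<lambda>i j. A $$ (i,j)) S"
    using assms by (simp add: weight_def principal_minor_eq_det_submatrix)
  also have "\<dots> = principal_minor (entries A) S"
    using assms finite_subset[OF assms(3)] by (simp add: entries_def principal_minor_restr)
  also have "\<dots> = (pfaffian (entries A) n S)\<^sup>2"
    using entries_skew[OF assms(1,2)] assms(3) by (rule principal_minor_eq_pfaffian_squared)
  finally show ?thesis .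
qed

subsection \<open>Fermionic modes\<close>

text \<open>The rows \<open>(u j, v j)\<close> are orthonormal in dimension \<open>2 n\<close> and
  isotropic for the pairing that exchanges the halves. By the anticommutator formula these are the
  canonical anticommutation relations for \<open>d j\<close> and its adjoint
  \<open>c j\<close>.\<close>

locale fermion_modes =
  fixes n :: nat and u v :: "nat \<Rightarrow> nat \<Rightarrow> real"
  assumes isotropic: "j < n \<Longrightarrow> k < n \<Longrightarrow> (\<Sum>i<n. u j i * v k i + v j i * u k i) = 0"
    and orthonormal: "j < n \<Longrightarrow> k < n \<Longrightarrow> (\<Sum>i<n. u j i * u k i + v j i * v k i) = of_bool (j = k)"
begin

definition d :: "nat \<Rightarrow> (nat set \<Rightarrow> real) \<Rightarrow> nat set \<Rightarrow> real" where
  "d j = clifford n (u j) (v j)"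

definition c :: "nat \<Rightarrow> (nat set \<Rightarrow> real) \<Rightarrow> nat set \<Rightarrow> real" where
  "c j = clifford n (v j) (u j)"

abbreviation norm2 :: "(nat set \<Rightarrow> real) \<Rightarrow> real" where
  "norm2 f \<equiv> ip n f f"

lemma d_d:
  assumes "j < n" "k < n"
  shows "d j (d k f) = (\<lambda>Y. - d k (d j f) Y)"
  using clifford_anticommutator[of n "u j" "v j" "u k" "v k" f] isotropic[OF assms]
  by (simp add: d_def fun_eq_iff add_eq_0_iff)

lemma c_c:
  assumes "j < n" "k < n"
  shows "c j (c k f) = (\<lambda>Y. - c k (c j f) Y)"
  using clifford_anticommutator[of n "v j" "u j" "v k" "u k" f] isotropic[OF assms]
  by (simp add: c_def fun_eq_iff add_eq_0_iff add.commute)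

lemma d_c:
  assumes "j < n" "k < n"
  shows "d j (c k f) Y + c k (d j f) Y = of_bool (j = k) * f Y"
  using clifford_anticommutator[of n "u j" "v j" "v k" "u k" f] orthonormal[OF assms]
  by (simp add: c_def d_def)

lemma ip_d: "ip n (d j f) g = ip n f (c j g)"
  by (simp add: c_def d_def clifford_adjoint)

lemma ip_c: "ip n (c j f) g = ip n f (d j g)"
  by (simp add: c_def d_def clifford_adjoint)

lemma d_scale: "d j (\<lambda>Y. s * f Y) = (\<lambda>Y. s * d j f Y)"
  by (simp add: d_def clifford_scale fun_eq_iff)

lemma c_scale: "c j (\<lambda>Y. s * f Y) = (\<lambda>Y. s * c j f Y)"
  by (simp add: c_def clifford_scale fun_eq_iff)

text \<open>The two products of \<open>d j\<close> with its adjoint add up to the identity; the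
  summands are the weights of \<open>f\<close> with mode \<open>j\<close> occupied and
  empty.\<close>

lemma norm2_split:
  assumes "j < n"
  shows "norm2 f = norm2 (d j f) + norm2 (c j f)"
proof -
  have "norm2 (d j f) + norm2 (c j f) = ip n f (c j (d j f)) + ip n f (d j (c j f))"
    by (simp only: ip_d ip_c)
  also have "\<dots> = ip n f (\<lambda>Y. d j (c j f) Y + c j (d j f) Y)"
    by (simp add: ip_def sum.distrib algebra_simps)
  also have "\<dots> = norm2 f"
    using d_c[OF assms assms] by simp
  finally show ?thesis ..
qed

lemma norm2_d_d:
  assumes "j < n" "k < n"
  shows "norm2 (d j (d k f)) = norm2 (d k (d j f))"
  using d_d[OF assms] by (simp add: ip_uminus)

lemma d_c_anticommute:
  assumes "j < n" "k < n" "j \<noteq> k"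
  shows "d j (c k f) = (\<lambda>Y. - 1 * c k (d j f) Y)"
  using d_c[OF assms(1,2), of f] assms(3) by (simp add: fun_eq_iff add_eq_0_iff2)

lemma norm2_d_c:
  assumes "j < n" "k < n" "j \<noteq> k"
  shows "norm2 (d j (c k f)) = norm2 (c k (d j f))"
  using d_c_anticommute[OF assms] by (simp add: ip_uminus)

lemma d_squared:
  assumes "j < n"
  shows "d j (d j f) = (\<lambda>_. 0)"
proof
  fix Y
  show "d j (d j f) Y = 0"
    using fun_cong[OF d_d[OF assms assms, of f], of Y] by simp
qed

text \<open>
  \<open>fill m\<close> is the projection onto the vacuum of the first \<open>m\<close> modes followed by an isometry, so its norm
  measures the component of \<open>f\<close> in that vacuum.
\<close>

primrec fill :: "nat \<Rightarrow> (nat set \<Rightarrow> real) \<Rightarrow> nat set \<Rightarrow> real" where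
  "fill 0 f = f"
| "fill (Suc m) f = fill m (c m f)"

text \<open>The adjoint of \<open>fill m\<close>: the annihilators come in the opposite
  order.\<close>

primrec empty_modes :: "nat \<Rightarrow> (nat set \<Rightarrow> real) \<Rightarrow> nat set \<Rightarrow> real" where
  "empty_modes 0 f = f"
| "empty_modes (Suc m) f = d m (empty_modes m f)"

lemma fill_scale: "fill m (\<lambda>Y. s * f Y) = (\<lambda>Y. s * fill m f Y)"
  by (induction m arbitrary: f) (simp_all add: c_scale)

lemma fill_uminus: "fill m (\<lambda>Y. - f Y) = (\<lambda>Y. - fill m f Y)"
  using fill_scale[of m "-1" f] by simp

lemma fill_d:
  assumes "m \<le> j" "j < n"
  shows "fill m (d j f) = (\<lambda>Y. (-1) ^ m * d j (fill m f) Y)"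
  using assms
proof (induction m arbitrary: f)
  case (Suc m)
  then have "c m (d j f) = (\<lambda>Y. - d j (c m f) Y)"
    using d_c_anticommute[of j m f] by simp
  then have "fill (Suc m) (d j f) = (\<lambda>Y. - fill m (d j (c m f)) Y)"
    by (simp add: fill_uminus)
  also have "\<dots> = (\<lambda>Y. (-1) ^ Suc m * d j (fill (Suc m) f) Y)"
    using Suc by simp
  finally show ?case .
qed simp

lemma fill_c:
  assumes "m \<le> j" "j < n"
  shows "fill m (c j f) = (\<lambda>Y. (-1) ^ m * c j (fill m f) Y)"
  using assms
proof (induction m arbitrary: f)
  case (Suc m)
  then have "c m (c j f) = (\<lambda>Y. - c j (c m f) Y)"
    by (intro c_c) auto
  then have "fill (Suc m) (c j f) = (\<lambda>Y. - fill m (c j (c m f)) Y)"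
    by (simp add: fill_uminus)
  also have "\<dots> = (\<lambda>Y. (-1) ^ Suc m * c j (fill (Suc m) f) Y)"
    using Suc by simp
  finally show ?case .
qed simp

lemma norm2_scale: "norm2 (\<lambda>Y. s * f Y) = s\<^sup>2 * norm2 f"
  by (simp add: ip_def sum_distrib_left power2_eq_square algebra_simps)

lemma norm2_fill_d:
  assumes "m \<le> j" "j < n"
  shows "norm2 (fill m (d j f)) = norm2 (d j (fill m f))"
  unfolding fill_d[OF assms] norm2_scale by (simp flip: power_mult)

text \<open>After \<open>d m\<close> the mode \<open>m\<close> is empty, since \<open>d m\<close>
  squares to zero, so \<open>c m\<close> preserves the norm; moving the operators out of
  \<open>fill m\<close> costs only signs.\<close>

lemma norm2_fill_c_d:
  assumes "m < n"
  shows "norm2 (fill m (c m (d m f))) = norm2 (fill m (d m f))"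
proof -
  have "norm2 (fill m (c m (d m f))) = norm2 (c m (fill m (d m f)))"
    using assms unfolding fill_c[OF order.refl assms] norm2_scale by (simp flip: power_mult)
  also have "\<dots> = norm2 (c m (d m (fill m f)))"
    unfolding fill_d[OF order.refl assms] c_scale norm2_scale by (simp flip: power_mult)
  also have "\<dots> = norm2 (d m (fill m f))"
    using norm2_split[OF assms, of "d m (fill m f)"] d_squared[OF assms] by (simp add: ip_def)
  also have "\<dots> = norm2 (fill m (d m f))"
    using assms by (intro norm2_fill_d[symmetric]) auto
  finally show ?thesis .
qed

section \<open>Lower bounds for the particle number\<close>

definition occupation :: "nat \<Rightarrow> (nat set \<Rightarrow> real) \<Rightarrow> real" where
  "occupation m f = (\<Sum>j<m. norm2 (d j f))"

text \<open>Each term splits along mode \<open>m\<close>, and anticommutation reduces the count to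
  the components of \<open>f\<close> with that mode occupied or empty. Both inductions below follow
  this recursion.\<close>

lemma occupation_Suc:
  assumes "m < n"
  shows "occupation (Suc m) f = occupation m (d m f) + occupation m (c m f) + norm2 (d m f)"
proof -
  have "norm2 (d j f) = norm2 (d j (d m f)) + norm2 (d j (c m f))" if "j < m" for j
    using norm2_split[OF assms, of "d j f"] norm2_d_d[of m j f] norm2_d_c[of j m f] that assms
    by simp
  then show ?thesis
    by (simp add: occupation_def sum.distrib)
qed

lemma occupation_nonneg: "0 \<le> occupation m f"
  by (simp add: occupation_def sum_nonneg ip_nonneg)

lemma occupation_ge_1:
  assumes "m \<le> n"
  shows "norm2 f - norm2 (fill m f) \<le> occupation m f"
  using assms
proof (induction m arbitrary: f)
  case (Suc m)
  then show ?case
    using Suc.IH[of "c m f"] occupation_nonneg[of m "d m f"] norm2_split[of m f]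
    by (simp add: occupation_Suc add_increasing)
qed (simp add: occupation_def)

text \<open>Only components with fewer than two particles can violate a bound by two. The subtracted
  terms are twice the weight without particles and the weights with one:
  \<open>norm2 (fill m (d j f))\<close> belongs to the component in which \<open>j\<close> alone
  among the first \<open>m\<close> modes is occupied.\<close>

lemma occupation_ge_2:
  assumes "m \<le> n"
  shows "2 * norm2 f - 2 * norm2 (fill m f) - (\<Sum>j<m. norm2 (fill m (d j f))) \<le> occupation m f"
  using assms
proof (induction m arbitrary: f)
  case (Suc m)
  then have m: "m < n" by simp
  have "(\<Sum>j<m. norm2 (fill m (d j (c m f)))) = (\<Sum>j<m. norm2 (fill m (c m (d j f))))"
  proof (intro sum.cong refl)
    fix j assume "j \<in> {..<m}"
    then have "d j (c m f) = (\<lambda>Y. - c m (d j f) Y)"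
      using d_c_anticommute[of j m f] m by simp
    then show "norm2 (fill m (d j (c m f))) = norm2 (fill m (c m (d j f)))"
      by (simp add: fill_uminus ip_uminus)
  qed
  \<comment> \<open>If mode \<open>m\<close> is empty, the induction hypothesis applies; if it is
    occupied, one particle is already counted and the bound by one suffices for the rest.\<close>
  then show ?case
    using Suc.IH[of "c m f"] occupation_ge_1[of m "d m f"] norm2_split[OF m, of f] m
      norm2_fill_c_d[OF m, of f]
    by (simp add: occupation_Suc)
qed (simp add: occupation_def)

lemma ip_fill: "ip n (fill m f) g = ip n f (empty_modes m g)"
  by (induction m arbitrary: f) (simp_all add: ip_c)

lemma d_empty_modes:
  assumes "j < m" "m \<le> n"
  shows "d j (empty_modes m g) = (\<lambda>_. 0)"
  using assms
proof (induction m)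
  case (Suc m)
  show ?case
  proof (cases "j = m")
    case True
    then show ?thesis using Suc.prems by (simp add: d_squared)
  next
    case False
    then have "d j (empty_modes m g) = (\<lambda>_. 0)" using Suc by simp
    then have "d m (d j (empty_modes m g)) = (\<lambda>_. 0)"
      using d_scale[of m 0 "\<lambda>_. 0"] by simp
    then show ?thesis
      using d_d[of j m "empty_modes m g"] False Suc.prems by simp
  qed
qed simp

text \<open>Bessel's inequality in dimension \<open>2 n\<close>: \<open>d j f Y\<close> is the inner
  product of the orthonormal row \<open>(u j, v j)\<close> with a vector of signed neighbour values
  of \<open>f\<close>.\<close>

lemma d_bessel: "(\<Sum>j<n. (d j f Y)\<^sup>2) \<le> (\<Sum>k<n. (f (flip Y k))\<^sup>2)"
proof -
  let ?K = "{..<n} \<times> (UNIV :: bool set)"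
  define x where "x j = (\<lambda>(k, b). if b then v j k else u j k)" for j
  \<comment> \<open>Each \<open>k\<close> fills one of its two slots, according to whether the
    creator or the annihilator coefficient is read at \<open>Y\<close>.\<close>
  define y where "y = (\<lambda>(k, b). if b = (k \<in> Y) then sgn_below k Y * f (flip Y k) else 0)"
  define z where "z j = (\<Sum>\<kappa>\<in>?K. x j \<kappa> * y \<kappa>)" for j
  have K: "(\<Sum>\<kappa>\<in>?K. h \<kappa>) = (\<Sum>k<n. h (k, False) + h (k, True))" for h :: "nat \<times> bool \<Rightarrow> real"
    by (simp add: sum.cartesian_product[symmetric, of "\<lambda>k b. h (k, b)", simplified] UNIV_bool add.commute)
  have z: "z j = d j f Y" for j
    unfolding z_def K d_def clifford_def by (intro sum.cong) (auto simp: x_def y_def)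
  have orth: "(\<Sum>\<kappa>\<in>?K. x j \<kappa> * x l \<kappa>) = of_bool (j = l)" if "j < n" "l < n" for j l
    unfolding K using orthonormal[OF that] by (simp add: x_def)
  have yy: "(\<Sum>\<kappa>\<in>?K. (y \<kappa>)\<^sup>2) = (\<Sum>k<n. (f (flip Y k))\<^sup>2)"
    unfolding K by (intro sum.cong)
      (auto simp: y_def power_mult_distrib power2_eq_square[of "sgn_below _ _"] sgn_below_squared)
  \<comment> \<open>The orthogonal projection of \<open>y\<close> onto the span of the rows.\<close>
  define p where "p \<kappa> = (\<Sum>j<n. z j * x j \<kappa>)" for \<kappa>
  have py: "(\<Sum>\<kappa>\<in>?K. p \<kappa> * y \<kappa>) = (\<Sum>j<n. (z j)\<^sup>2)"
  proof -
    have "(\<Sum>\<kappa>\<in>?K. p \<kappa> * y \<kappa>) = (\<Sum>j<n. \<Sum>\<kappa>\<in>?K. z j * x j \<kappa> * y \<kappa>)"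
      unfolding p_def sum_distrib_right by (rule sum.swap)
    then show ?thesis
      by (simp add: z_def power2_eq_square sum_distrib_left mult.assoc)
  qed
  have pp: "(\<Sum>\<kappa>\<in>?K. (p \<kappa>)\<^sup>2) = (\<Sum>j<n. (z j)\<^sup>2)"
  proof -
    have "(\<Sum>\<kappa>\<in>?K. (p \<kappa>)\<^sup>2) = (\<Sum>\<kappa>\<in>?K. \<Sum>j<n. \<Sum>l<n. z j * z l * (x j \<kappa> * x l \<kappa>))"
      by (simp add: p_def power2_eq_square sum_product algebra_simps)
    also have "\<dots> = (\<Sum>j<n. \<Sum>\<kappa>\<in>?K. \<Sum>l<n. z j * z l * (x j \<kappa> * x l \<kappa>))"
      by (rule sum.swap)
    also have "\<dots> = (\<Sum>j<n. \<Sum>l<n. \<Sum>\<kappa>\<in>?K. z j * z l * (x j \<kappa> * x l \<kappa>))"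
      by (intro sum.cong refl sum.swap)
    also have "\<dots> = (\<Sum>j<n. \<Sum>l<n. of_bool (l = j) * (z j * z l))"
      unfolding sum_distrib_left[symmetric] using orth by (intro sum.cong refl) auto
    also have "\<dots> = (\<Sum>j<n. (z j)\<^sup>2)"
      by (intro sum.cong refl) (simp add: sum_of_bool_mult power2_eq_square)
    finally show ?thesis .
  qed
  have "0 \<le> (\<Sum>\<kappa>\<in>?K. (y \<kappa> - p \<kappa>)\<^sup>2)"
    by (intro sum_nonneg) auto
  also have "\<dots> = (\<Sum>\<kappa>\<in>?K. (y \<kappa>)\<^sup>2) - 2 * (\<Sum>\<kappa>\<in>?K. p \<kappa> * y \<kappa>) + (\<Sum>\<kappa>\<in>?K. (p \<kappa>)\<^sup>2)"
    by (simp add: power2_diff sum.distrib sum_subtractf sum_distrib_left algebra_simps)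
  finally show ?thesis
    unfolding py pp yy by (simp add: z)
qed

end

section \<open>Modes from the resolvent of the matrix\<close>

lemma inverse_nonsingular:
  assumes M: "M \<in> carrier_mat n n" and "det (M :: real mat) \<noteq> 0"
  obtains R where "\<And>i j. i < n \<Longrightarrow> j < n \<Longrightarrow> (\<Sum>k<n. M $$ (i,k) * R k j) = of_bool (i = j)"
    and "\<And>i j. i < n \<Longrightarrow> j < n \<Longrightarrow> (\<Sum>k<n. R i k * M $$ (k,j)) = of_bool (i = j)"
proof -
  from det_non_zero_imp_unit[OF assms] obtain B
    where B: "B \<in> carrier_mat n n" "M * B = 1\<^sub>m n" "B * M = 1\<^sub>m n"
    by (auto simp: Units_def ring_mat_simps)
  show ?thesis
  proof (rule that[of "\<lambda>i j. B $$ (i,j)"])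
    fix i j assume ij: "i < n" "j < n"
    have "(M * B) $$ (i,j) = (\<Sum>k<n. M $$ (i,k) * B $$ (k,j))"
      using ij M B(1) by (simp add: scalar_prod_def atLeast0LessThan)
    then show "(\<Sum>k<n. M $$ (i,k) * B $$ (k,j)) = of_bool (i = j)"
      unfolding B(2) using ij by (simp only: index_one_mat of_bool_def)
    have "(B * M) $$ (i,j) = (\<Sum>k<n. B $$ (i,k) * M $$ (k,j))"
      using ij M B(1) by (simp add: scalar_prod_def atLeast0LessThan)
    then show "(\<Sum>k<n. B $$ (i,k) * M $$ (k,j)) = of_bool (i = j)"
      unfolding B(3) using ij by (simp only: index_one_mat of_bool_def)
  qed
qed

text \<open>\<open>R\<close> is the transposed inverse of \<open>1 + A\<close>, by skew-symmetry the
  inverse of \<open>1 - A\<close>. Of the two inverse identities, the first shapes the modes and the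
  second undoes the change of modes.\<close>

lemma resolvent_exists:
  assumes skew: "\<And>i j. a i j = - a j i"
  obtains R :: "nat \<Rightarrow> nat \<Rightarrow> real"
  where "\<And>j k. j < n \<Longrightarrow> k < n \<Longrightarrow> R j k + (\<Sum>l<n. a k l * R j l) = of_bool (j = k)"
    and "\<And>j k. j < n \<Longrightarrow> k < n \<Longrightarrow> R j k + (\<Sum>i<n. a i j * R i k) = of_bool (j = k)"
proof -
  have "det (one_plus a n) \<noteq> 0"
    using norm_pfaffian_pos[of n a] norm_pfaffian_eq_det[of a n, OF skew] by simp
  from inverse_nonsingular[OF one_plus_carrier this] obtain B
    where B1: "\<And>i j. i < n \<Longrightarrow> j < n \<Longrightarrow> (\<Sum>k<n. one_plus a n $$ (i,k) * B k j) = of_bool (i = j)"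
      and B2: "\<And>i j. i < n \<Longrightarrow> j < n \<Longrightarrow> (\<Sum>k<n. B i k * one_plus a n $$ (k,j)) = of_bool (i = j)"
    by blast
  show ?thesis
  proof (rule that[of "\<lambda>j k. B k j"])
    fix j k assume jk: "j < n" "k < n"
    have "(\<Sum>l<n. one_plus a n $$ (k,l) * B l j) = (\<Sum>l<n. of_bool (l = k) * B l j + a k l * B l j)"
      using jk by (intro sum.cong) (auto simp: one_plus_def distrib_right)
    then show "B k j + (\<Sum>l<n. a k l * B l j) = of_bool (j = k)"
      using jk B1[of k j] by (auto simp: sum.distrib sum_of_bool_mult)
    have "(\<Sum>i<n. B k i * one_plus a n $$ (i,j)) = (\<Sum>i<n. of_bool (i = j) * B k i + a i j * B k i)"
      using jk by (intro sum.cong) (auto simp: one_plus_def distrib_left)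
    then show "B k j + (\<Sum>i<n. a i j * B k i) = of_bool (j = k)"
      using jk B2[of k j] by (auto simp: sum.distrib sum_of_bool_mult)
  qed
qed

text \<open>In matrix form \<open>R = R (1 + A) R^T\<close>, where \<open>R A R^T\<close> is skew;
  symmetrising leaves twice \<open>R R^T\<close>.\<close>

lemma resolvent_symmetric_part:
  assumes skew: "\<And>i j. a i j = - a j i"
    and R: "\<And>j k. j < n \<Longrightarrow> k < n \<Longrightarrow> R j k + (\<Sum>l<n. a k l * R j l) = of_bool (j = k)"
    and jk: "j < n" "k < (n::nat)"
  shows "R j k + R k j = 2 * (\<Sum>i<n. R j i * (R k i :: real))"
proof -
  have "x j k = (\<Sum>i<n. R j i * R k i) + (\<Sum>i<n. \<Sum>l<n. a i l * R k l * R j i)"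
    if "j < n" "k < n" "x = (\<lambda>j k. \<Sum>i<n. R j i * of_bool (k = i))" for x j k
  proof -
    have "x j k = (\<Sum>i<n. R j i * (R k i + (\<Sum>l<n. a i l * R k l)))"
      using that R[of k] by (auto intro!: sum.cong)
    then show ?thesis
      by (simp add: distrib_left sum.distrib sum_distrib_left algebra_simps)
  qed
  note * = this[OF _ _ refl]
  have "(\<Sum>i<n. R j i * of_bool (k = i)) = (\<Sum>i<n. of_bool (i = k) * R j i)" for j k
    by (intro sum.cong) auto
  then have e: "(\<Sum>i<n. R j i * of_bool (k = i)) = R j k" if "k < n" for j k
    using that by (simp only: sum_of_bool_mult)
  have "(\<Sum>i<n. \<Sum>l<n. a i l * R j l * R k i) = (\<Sum>l<n. \<Sum>i<n. a i l * R j l * R k i)"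
    by (rule sum.swap)
  also have "\<dots> = (\<Sum>l<n. \<Sum>i<n. - (a l i * R k i * R j l))"
    using skew by (intro sum.cong refl) (metis minus_mult_left mult.assoc mult.commute)
  finally have "(\<Sum>i<n. \<Sum>l<n. a i l * R j l * R k i) = - (\<Sum>i<n. \<Sum>l<n. a i l * R k l * R j i)"
    by (simp add: sum_negf)
  moreover have "(\<Sum>i<n. R k i * R j i) = (\<Sum>i<n. R j i * R k i)"
    by (simp add: mult.commute)
  ultimately show ?thesis
    using *[of j k] *[of k j] jk by (simp add: e)
qed

text \<open>The modes are the vacuum relations multiplied by the invertible matrix \<open>R\<close>,
  which keeps their common kernel; the formula for the symmetric part of \<open>R\<close> makes the
  coefficient rows isotropic and orthonormal.\<close>

lemma modes_exist:
  assumes skew: "\<And>i j. a i j = - a j i"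
  obtains u v where "fermion_modes n u v"
    and "\<And>j Y. j < n \<Longrightarrow> clifford n (u j) (v j) (pfaffian a n) Y = 0"
    and "\<And>\<theta> S. (\<And>j Y. j < n \<Longrightarrow> clifford n (u j) (v j) \<theta> Y = 0) \<Longrightarrow> S \<subseteq> {..<n}
      \<Longrightarrow> \<theta> S = \<theta> {} * pfaffian a n S"
proof -
  obtain R where R1: "\<And>j k. j < n \<Longrightarrow> k < n \<Longrightarrow> R j k + (\<Sum>l<n. a k l * R j l) = of_bool (j = k)"
    and R2: "\<And>j k. j < n \<Longrightarrow> k < n \<Longrightarrow> R j k + (\<Sum>i<n. a i j * R i k) = of_bool (j = k)"
    using resolvent_exists[of a n, OF skew] by blast
  \<comment> \<open>\<open>R (1 - A) = 1\<close> gives \<open>- R A = 1 - R\<close>, the creator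
    coefficients of the transformed relations.\<close>
  define v where "v j k = of_bool (k = j) - R j k" for j k
  note sym = resolvent_symmetric_part[of a n R, OF skew R1]
  have e: "(\<Sum>i<n. R j i * of_bool (i = k)) = R j k" if "k < n" for j k
  proof -
    have "(\<Sum>i<n. R j i * of_bool (i = k)) = (\<Sum>i<n. of_bool (i = k) * R j i)"
      by (simp add: mult.commute)
    then show ?thesis using that by (simp only: sum_of_bool_mult)
  qed
  have "fermion_modes n R v"
  proof
    fix j k assume jk: "j < n" "k < n"
    have "(\<Sum>i<n. R j i * v k i + v j i * R k i)
        = (\<Sum>i<n. R j i * of_bool (i = k) + R k i * of_bool (i = j) - 2 * (R j i * R k i))"
      by (intro sum.cong) (auto simp: v_def algebra_simps)
    also have "\<dots> = R j k + R k j - 2 * (\<Sum>i<n. R j i * R k i)"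
      using jk by (simp add: sum.distrib sum_subtractf e sum_distrib_left)
    finally show "(\<Sum>i<n. R j i * v k i + v j i * R k i) = 0"
      using sym[of j k] jk by simp
    have "(\<Sum>i<n. R j i * R k i + v j i * v k i) = (\<Sum>i<n. of_bool (i = k) * of_bool (j = k)
        - R j i * of_bool (i = k) - R k i * of_bool (i = j) + 2 * (R j i * R k i))"
      by (intro sum.cong) (auto simp: v_def algebra_simps)
    also have "\<dots> = of_bool (j = k) - R j k - R k j + 2 * (\<Sum>i<n. R j i * R k i)"
      using jk by (simp only: sum.distrib sum_subtractf e sum_distrib_left[symmetric] sum_of_bool_mult)
    finally show "(\<Sum>i<n. R j i * R k i + v j i * v k i) = of_bool (j = k)"
      using sym[of j k] jk by simp
  qed
  moreover
  let ?A = "\<lambda>j. clifford n (\<lambda>k. of_bool (k = j)) (\<lambda>k. - a j k)"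
  have d: "clifford n (R j) (v j) f Y = (\<Sum>i<n. R j i * ?A i f Y)" if j: "j < n" for j f Y
    unfolding clifford_sum_coeff[symmetric]
  proof (rule clifford_cong)
    fix k assume k: "k < n"
    have "(\<Sum>i<n. R j i * of_bool (k = i)) = (\<Sum>i<n. R j i * of_bool (i = k))"
      by (intro sum.cong) auto
    then show "R j k = (\<Sum>i<n. R j i * of_bool (k = i))"
      using e[OF k, of j] by simp
    have "(\<Sum>i<n. R j i * - a i k) = (\<Sum>i<n. a k i * R j i)"
      using skew by (intro sum.cong refl) (metis mult.commute)
    then show "v j k = (\<Sum>i<n. R j i * - a i k)"
      using R1[OF j k] by (auto simp: v_def)
  qed simp
  have "clifford n (R j) (v j) (pfaffian a n) Y = 0" if "j < n" for j Y
    unfolding d[OF that] using pfaffian_annihilated[of a, OF skew] by (intro sum.neutral) simp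
  moreover have "\<theta> S = \<theta> {} * pfaffian a n S"
    if vac: "\<And>j Y. j < n \<Longrightarrow> clifford n (R j) (v j) \<theta> Y = 0" and "S \<subseteq> {..<n}" for \<theta> S
    using skew _ \<open>S \<subseteq> {..<n}\<close>
  proof (rule vacuum_unique)
    fix j Y assume j: "j < n"
    \<comment> \<open>The second resolvent identity recovers the relation \<open>?A j\<close> as a
      combination of the modes.\<close>
    have "0 = clifford n (R j) (v j) \<theta> Y + (\<Sum>l<n. a l j * clifford n (R l) (v l) \<theta> Y)"
      using vac j by simp
    also have "\<dots> = (\<Sum>i<n. R j i * ?A i \<theta> Y) + (\<Sum>l<n. \<Sum>i<n. a l j * R l i * ?A i \<theta> Y)"
      using j by (simp add: d sum_distrib_left mult.assoc)
    also have "(\<Sum>l<n. \<Sum>i<n. a l j * R l i * ?A i \<theta> Y) = (\<Sum>i<n. \<Sum>l<n. a l j * R l i * ?A i \<theta> Y)"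
      by (rule sum.swap)
    also have "(\<Sum>i<n. R j i * ?A i \<theta> Y) + \<dots> = (\<Sum>i<n. (R j i + (\<Sum>l<n. a l j * R l i)) * ?A i \<theta> Y)"
      by (simp add: sum.distrib distrib_right sum_distrib_right)
    also have "\<dots> = (\<Sum>i<n. of_bool (i = j) * ?A i \<theta> Y)"
      using R2[OF j] by (intro sum.cong) auto
    also have "\<dots> = ?A j \<theta> Y"
      using j by (rule sum_of_bool_mult)
    finally show "?A j \<theta> Y = 0" ..
  qed
  ultimately show ?thesis by (rule that)
qed

text \<open>Orthogonality to the vacuum removes the component without particles. Each
  \<open>d j\<close> changes parity while the Pfaffian lives on even sets, so the components with
  one particle vanish too.\<close>

lemma (in fermion_modes) occupation_ge_2_norm2:
  assumes vac: "\<And>\<theta> S. (\<And>j Y. j < n \<Longrightarrow> d j \<theta> Y = 0) \<Longrightarrow> S \<subseteq> {..<n} \<Longrightarrow> \<theta> S = \<theta> {} * pfaffian a n S"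
    and orth: "ip n f (pfaffian a n) = 0"
    and even: "\<And>Y. Y \<subseteq> {..<n} \<Longrightarrow> odd (card Y) \<Longrightarrow> f Y = 0"
  shows "2 * norm2 f \<le> occupation n f"
proof -
  \<comment> \<open>The squared norm is the pairing of \<open>g\<close> with
    \<open>\<theta>\<close>, which every \<open>d j\<close> kills and which is therefore a multiple
    of the Pfaffian.\<close>
  have fill0: "norm2 (fill n g) = 0" if "ip n g (pfaffian a n) = 0" for g
  proof -
    define \<theta> where "\<theta> = empty_modes n (fill n g)"
    define t where "t = \<theta> {}"
    have "\<theta> S = t * pfaffian a n S" if "S \<subseteq> {..<n}" for S
      unfolding t_def
    proof (rule vac[OF _ that])
      show "d j \<theta> Y = 0" if "j < n" for j Y
        using d_empty_modes[OF that order.refl] by (simp add: \<theta>_def)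
    qed
    then have "ip n g \<theta> = ip n g (\<lambda>S. t * pfaffian a n S)"
      by (simp add: ip_def)
    also have "\<dots> = t * ip n g (pfaffian a n)"
      by (simp add: ip_def sum_distrib_left algebra_simps)
    finally show ?thesis
      using that by (simp add: \<theta>_def ip_fill)
  qed
  have "ip n (d j f) (pfaffian a n) = 0" for j
  proof -
    have "f Y * c j (pfaffian a n) Y = 0" if "Y \<in> Pow {..<n}" for Y
    proof (cases "odd (card Y)")
      case True
      then show ?thesis using even that by simp
    next
      case False
      have "finite Y" using that finite_subset by blast
      then have "pfaffian a n (flip Y k) = 0" for k
        using False by (intro pfaffian_odd) (simp_all add: card_flip_parity)
      then show ?thesis by (simp add: c_def clifford_def)
    qed
    then show ?thesis
      unfolding ip_d unfolding ip_def by (intro sum.neutral) blast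
  qed
  then show ?thesis
    using occupation_ge_2[OF order.refl, of f] fill0 orth by simp
qed

section \<open>The Poincare inequality for squared Pfaffian weights\<close>

lemma sum_squares_minus_projection:
  fixes x y :: "nat \<Rightarrow> real"
  shows "(\<Sum>i<n. (y i - (\<Sum>i<n. x i * y i) / (\<Sum>i<n. (x i)\<^sup>2) * x i)\<^sup>2)
    = (\<Sum>i<n. (y i)\<^sup>2) - (\<Sum>i<n. x i * y i)\<^sup>2 / (\<Sum>i<n. (x i)\<^sup>2)"
proof -
  define G where "G = (\<Sum>i<n. x i * y i)"
  define W where "W = (\<Sum>i<n. (x i)\<^sup>2)"
  have "(\<Sum>i<n. (y i - c * x i)\<^sup>2) = (\<Sum>i<n. (y i)\<^sup>2) - 2 * c * G + c\<^sup>2 * W" for c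
    unfolding G_def W_def
    by (simp add: power2_diff power_mult_distrib sum.distrib sum_subtractf sum_distrib_left algebra_simps)
  then have "(\<Sum>i<n. (y i - G / W * x i)\<^sup>2) = (\<Sum>i<n. (y i)\<^sup>2) - 2 * (G / W) * G + (G / W)\<^sup>2 * W"
    by blast
  \<comment> \<open>If \<open>W = 0\<close>, division by zero gives 0 and both sides are the plain
    sum of squares, so a set \<open>Y\<close> without neighbouring states needs no separate
    treatment.\<close>
  also have "\<dots> = (\<Sum>i<n. (y i)\<^sup>2) - G\<^sup>2 / W"
    by (cases "W = 0") (simp_all add: power2_eq_square field_simps)
  finally show ?thesis
    unfolding G_def W_def .
qed

text \<open>Bounds \<open>occupation n\<close> from below by two particles and from above, at each
  \<open>Y\<close>, by Bessel. Summands on the right are conditional variances at \<open>Y\<close>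
  times the total weight of its neighbours.\<close>

lemma poincare_pfaffian:
  fixes n :: nat and f :: "nat set \<Rightarrow> real"
  assumes skew: "\<And>i j. a i j = - a j i"
  defines "w \<equiv> \<lambda>S. (pfaffian a n S)\<^sup>2"
  defines "m \<equiv> (\<Sum>S\<in>Pow {..<n}. w S * f S) / (\<Sum>S\<in>Pow {..<n}. w S)"
  shows "2 * (\<Sum>S\<in>Pow {..<n}. w S * (f S - m)\<^sup>2)
    \<le> (\<Sum>Y\<in>Pow {..<n}. (\<Sum>i<n. w (flip Y i) * (f (flip Y i))\<^sup>2)
        - (\<Sum>i<n. w (flip Y i) * f (flip Y i))\<^sup>2 / (\<Sum>i<n. w (flip Y i)))"
proof -
  obtain u v where "fermion_modes n u v"
    and ann: "\<And>j Y. j < n \<Longrightarrow> clifford n (u j) (v j) (pfaffian a n) Y = 0"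
    and vac: "\<And>\<theta> S. (\<And>j Y. j < n \<Longrightarrow> clifford n (u j) (v j) \<theta> Y = 0) \<Longrightarrow> S \<subseteq> {..<n}
      \<Longrightarrow> \<theta> S = \<theta> {} * pfaffian a n S"
    using modes_exist[of a n, OF skew] by blast
  then interpret fermion_modes n u v by simp
  define \<psi> where "\<psi> = pfaffian a n"
  define \<phi> where "\<phi> S = f S * \<psi> S" for S
  define \<phi>' where "\<phi>' S = \<phi> S - m * \<psi> S" for S
  have Z: "(\<Sum>S\<in>Pow {..<n}. w S) > 0"
    using norm_pfaffian_pos[of n a] by (simp add: ip_def w_def power2_eq_square)
  have "ip n \<phi>' \<psi> = (\<Sum>S\<in>Pow {..<n}. w S * f S) - m * (\<Sum>S\<in>Pow {..<n}. w S)"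
    by (simp add: ip_def \<phi>'_def \<phi>_def w_def \<psi>_def power2_eq_square sum_subtractf sum_distrib_left
        algebra_simps)
  then have orth: "ip n \<phi>' \<psi> = 0"
    using Z by (simp add: m_def)
  have "\<phi>' Y = 0" if "Y \<subseteq> {..<n}" "odd (card Y)" for Y
    using pfaffian_odd[of Y a n] that finite_subset[OF that(1)] by (simp add: \<phi>'_def \<phi>_def \<psi>_def)
  then have "2 * norm2 \<phi>' \<le> occupation n \<phi>'"
    using orth by (intro occupation_ge_2_norm2[of a] vac) (auto simp: d_def \<psi>_def)
  moreover have "norm2 \<phi>' = (\<Sum>S\<in>Pow {..<n}. w S * (f S - m)\<^sup>2)"
    unfolding ip_def by (intro sum.cong)
      (auto simp: \<phi>'_def \<phi>_def w_def \<psi>_def power2_eq_square algebra_simps)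
  moreover have "occupation n \<phi>' = (\<Sum>Y\<in>Pow {..<n}. \<Sum>j<n. (d j \<phi> Y)\<^sup>2)"
  proof -
    have "d j \<phi>' Y = d j \<phi> Y" if "j < n" for j Y
      using ann[OF that] unfolding d_def \<phi>'_def clifford_diff \<psi>_def by simp
    then have "occupation n \<phi>' = (\<Sum>j<n. \<Sum>Y\<in>Pow {..<n}. (d j \<phi> Y)\<^sup>2)"
      by (simp add: occupation_def ip_def power2_eq_square)
    also have "\<dots> = (\<Sum>Y\<in>Pow {..<n}. \<Sum>j<n. (d j \<phi> Y)\<^sup>2)"
      by (rule sum.swap)
    finally show ?thesis .
  qed
  moreover have "(\<Sum>j<n. (d j \<phi> Y)\<^sup>2) \<le> (\<Sum>i<n. w (flip Y i) * (f (flip Y i))\<^sup>2)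
      - (\<Sum>i<n. w (flip Y i) * f (flip Y i))\<^sup>2 / (\<Sum>i<n. w (flip Y i))" for Y
  proof -
    \<comment> \<open>The conditional mean of \<open>f\<close> among the neighbours of
      \<open>Y\<close>, the multiple of \<open>\<psi>\<close> that minimises the Bessel
      bound.\<close>
    define c where "c = (\<Sum>i<n. \<psi> (flip Y i) * \<phi> (flip Y i)) / (\<Sum>i<n. (\<psi> (flip Y i))\<^sup>2)"
    have "(\<Sum>j<n. (d j \<phi> Y)\<^sup>2) = (\<Sum>j<n. (d j (\<lambda>S. \<phi> S - c * \<psi> S) Y)\<^sup>2)"
      using ann unfolding d_def clifford_diff \<psi>_def by simp
    also have "\<dots> \<le> (\<Sum>i<n. (\<phi> (flip Y i) - c * \<psi> (flip Y i))\<^sup>2)"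
      by (rule d_bessel)
    also have "\<dots> = (\<Sum>i<n. (\<phi> (flip Y i))\<^sup>2)
        - (\<Sum>i<n. \<psi> (flip Y i) * \<phi> (flip Y i))\<^sup>2 / (\<Sum>i<n. (\<psi> (flip Y i))\<^sup>2)"
      unfolding c_def by (rule sum_squares_minus_projection)
    also have "\<dots> = (\<Sum>i<n. w (flip Y i) * (f (flip Y i))\<^sup>2)
      - (\<Sum>i<n. w (flip Y i) * f (flip Y i))\<^sup>2 / (\<Sum>i<n. w (flip Y i))"
      by (simp add: \<phi>_def \<psi>_def w_def power_mult_distrib power2_eq_square algebra_simps)
    finally show ?thesis .
  qed
  ultimately show ?thesis
    by (smt (verit) sum_mono)
qed

subsection \<open>The flip--repair walk\<close>

lemma sum_states:
  assumes nonneg: "\<And>S. S \<subseteq> {..<dim_row A} \<Longrightarrow> 0 \<le> weight A S"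
  shows "(\<Sum>S\<in>states A. weight A S * h S) = (\<Sum>S\<in>Pow {..<dim_row A}. weight A S * h S)"
proof (rule sum.mono_neutral_left)
  show "\<forall>S\<in>Pow {..<dim_row A} - states A. weight A S * h S = 0"
  proof
    fix S assume "S \<in> Pow {..<dim_row A} - states A"
    then have "weight A S = 0"
      using nonneg[of S] by (auto simp: states_def)
    then show "weight A S * h S = 0" by simp
  qed
qed (auto simp: states_def)

text \<open>The repair step is a conditional expectation: the sets at distance one from
  \<open>Y\<close> are its distinct flips, and those that are not states carry no weight.\<close>

lemma sum_repair_prob:
  assumes nonneg: "\<And>S. S \<subseteq> {..<dim_row A} \<Longrightarrow> 0 \<le> weight A S" and Y: "Y \<subseteq> {..<dim_row A}"
  shows "(\<Sum>T\<in>states A. repair_prob A Y T * f T)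
    = (\<Sum>j<dim_row A. weight A (flip Y j) * f (flip Y j)) / (\<Sum>j<dim_row A. weight A (flip Y j))"
proof -
  define n where "n = dim_row A"
  define W where "W = (\<Sum>j<n. weight A (flip Y j))"
  let ?F = "flip Y ` {..<n}"
  have inj: "inj_on (flip Y) {..<n}"
  proof (rule inj_onI)
    fix i j assume "flip Y i = flip Y j"
    then have "i \<in> flip Y i \<longleftrightarrow> i \<in> flip Y j" by simp
    then show "i = j" by auto
  qed
  have F: "?F \<subseteq> Pow {..<n}"
    using Y by (auto simp: flip_def n_def)
  have near: "card (sym_diff T Y) = 1 \<longleftrightarrow> T \<in> ?F" if T: "T \<subseteq> {..<n}" for T
  proof
    assume "card (sym_diff T Y) = 1"
    then obtain j where j: "sym_diff T Y = {j}" by (auto simp: card_1_singleton_iff)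
    then have "j < n" using T Y by (auto simp: n_def)
    moreover have "T = flip Y j"
      using j unfolding flip_def by blast
    ultimately show "T \<in> ?F" by blast
  next
    assume "T \<in> ?F"
    then obtain j where "T = flip Y j" by blast
    then have "sym_diff T Y = {j}" by (auto simp: flip_def)
    then show "card (sym_diff T Y) = 1" by simp
  qed
  have "repair_prob A Y T = (if T \<in> ?F then weight A T / W else 0)" if "T \<in> states A" for T
    using near[of T] that by (simp add: repair_prob_def W_def n_def states_def flip_def)
  then have "(\<Sum>T\<in>states A. repair_prob A Y T * f T)
      = (\<Sum>T\<in>states A. weight A T * (if T \<in> ?F then f T / W else 0))"
    by (intro sum.cong) auto
  also have "\<dots> = (\<Sum>T\<in>Pow {..<n}. weight A T * (if T \<in> ?F then f T / W else 0))"
    unfolding n_def using nonneg by (rule sum_states)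
  also have "\<dots> = (\<Sum>T\<in>?F. weight A T * f T / W)"
    using F by (intro sum.mono_neutral_cong_right) auto
  also have "\<dots> = (\<Sum>j<n. weight A (flip Y j) * f (flip Y j)) / W"
    using inj by (simp add: sum.reindex sum_divide_distrib)
  finally show ?thesis
    by (simp add: W_def n_def)
qed

text \<open>The kernel averages the conditional means \<open>g\<close> over the flips of
  \<open>S\<close>. Regrouping the pairs of \<open>S\<close> and \<open>i\<close> by the
  intermediate set \<open>flip S i\<close> turns the form into a sum of conditional
  variances.\<close>

lemma dirichlet_form_flip_repair:
  fixes f :: "nat set \<Rightarrow> real"
  assumes A: "A \<in> carrier_mat n n" and "0 < n"
    and nonneg: "\<And>S. S \<subseteq> {..<n} \<Longrightarrow> 0 \<le> weight A S"
  shows "dirichlet_form (states A) (skew_det_measure A) (flip_repair A) f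
    = (\<Sum>Y\<in>Pow {..<n}. (\<Sum>i<n. weight A (flip Y i) * (f (flip Y i))\<^sup>2)
        - (\<Sum>i<n. weight A (flip Y i) * f (flip Y i))\<^sup>2 / (\<Sum>i<n. weight A (flip Y i)))
      / (real n * partition_function A)"
proof -
  define w where "w = weight A"
  define Z where "Z = partition_function A"
  define g where "g Y = (\<Sum>j<n. w (flip Y j) * f (flip Y j)) / (\<Sum>j<n. w (flip Y j))" for Y
  have dim: "dim_row A = n" using A by simp
  have states: "(\<Sum>S\<in>states A. w S * h S) = (\<Sum>S\<in>Pow {..<n}. w S * h S)" for h
    unfolding w_def dim[symmetric] using nonneg dim by (intro sum_states) simp
  have shift: "(\<Sum>S\<in>Pow {..<n}. \<Sum>i<n. h (flip S i) S) = (\<Sum>Y\<in>Pow {..<n}. \<Sum>i<n. h Y (flip Y i))"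
    for h :: "nat set \<Rightarrow> nat set \<Rightarrow> real"
  proof -
    have "(\<Sum>S\<in>Pow {..<n}. \<Sum>i<n. h (flip S i) S) = (\<Sum>i<n. \<Sum>S\<in>Pow {..<n}. h (flip S i) S)"
      by (rule sum.swap)
    also have "\<dots> = (\<Sum>i<n. \<Sum>S\<in>Pow {..<n}. h S (flip S i))"
    proof (rule sum.cong[OF refl])
      fix i assume "i \<in> {..<n}"
      then show "(\<Sum>S\<in>Pow {..<n}. h (flip S i) S) = (\<Sum>S\<in>Pow {..<n}. h S (flip S i))"
        using sum_flip[of i n "\<lambda>S. h S (flip S i)"] by simp
    qed
    also have "\<dots> = (\<Sum>Y\<in>Pow {..<n}. \<Sum>i<n. h Y (flip Y i))"
      by (rule sum.swap)
    finally show ?thesis .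
  qed
  have kernel: "apply_kernel (states A) (flip_repair A) f S = (\<Sum>i<n. g (flip S i)) / n"
    if "S \<in> states A" for S
  proof -
    have "S \<subseteq> {..<n}" using that dim by (simp add: states_def)
    have "apply_kernel (states A) (flip_repair A) f S
        = (\<Sum>T\<in>states A. \<Sum>i<n. 1 / n * (repair_prob A (flip S i) T * f T))"
      by (simp add: apply_kernel_def flip_repair_def dim sum_distrib_right flip_def mult.assoc)
    also have "\<dots> = (\<Sum>i<n. \<Sum>T\<in>states A. 1 / n * (repair_prob A (flip S i) T * f T))"
      by (rule sum.swap)
    also have "\<dots> = (\<Sum>i<n. 1 / n * g (flip S i))"
    proof (intro sum.cong refl)
      fix i assume "i \<in> {..<n}"
      then have "flip S i \<subseteq> {..<n}"
        using \<open>S \<subseteq> {..<n}\<close> by (auto simp: flip_def)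
      then have "(\<Sum>T\<in>states A. repair_prob A (flip S i) T * f T) = g (flip S i)"
        unfolding g_def w_def using nonneg dim by (subst sum_repair_prob) auto
      then show "(\<Sum>T\<in>states A. 1 / n * (repair_prob A (flip S i) T * f T)) = 1 / n * g (flip S i)"
        unfolding sum_distrib_left[symmetric] by simp
    qed
    finally show ?thesis
      by (simp add: sum_divide_distrib)
  qed
  have "dirichlet_form (states A) (skew_det_measure A) (flip_repair A) f
      = (\<Sum>S\<in>states A. w S * (f S * (f S - (\<Sum>i<n. g (flip S i)) / n) / Z))"
    unfolding dirichlet_form_def inner_on_def
    by (intro sum.cong refl) (simp add: kernel skew_det_measure_def w_def Z_def)
  also have "\<dots> = (\<Sum>S\<in>Pow {..<n}. w S * (f S * (f S - (\<Sum>i<n. g (flip S i)) / n) / Z))"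
    by (rule states)
  also have "\<dots> = (\<Sum>S\<in>Pow {..<n}. \<Sum>i<n. w S * (f S)\<^sup>2 - w S * f S * g (flip S i)) / (n * Z)"
    unfolding sum_divide_distrib[of _ "Pow {..<n}"]
  proof (intro sum.cong refl)
    fix S
    have "(\<Sum>i<n. w S * (f S)\<^sup>2 - w S * f S * g (flip S i))
        = n * (w S * (f S)\<^sup>2) - w S * f S * (\<Sum>i<n. g (flip S i))"
      by (simp add: sum_subtractf sum_distrib_left)
    then show "w S * (f S * (f S - (\<Sum>i<n. g (flip S i)) / n) / Z)
        = (\<Sum>i<n. w S * (f S)\<^sup>2 - w S * f S * g (flip S i)) / (n * Z)"
      using \<open>0 < n\<close> by (cases "Z = 0") (simp_all add: field_simps power2_eq_square)
  qed
  also have "(\<Sum>S\<in>Pow {..<n}. \<Sum>i<n. w S * (f S)\<^sup>2 - w S * f S * g (flip S i))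
      = (\<Sum>Y\<in>Pow {..<n}. \<Sum>i<n. w (flip Y i) * (f (flip Y i))\<^sup>2 - w (flip Y i) * f (flip Y i) * g Y)"
    by (rule shift)
  also have "\<dots> = (\<Sum>Y\<in>Pow {..<n}. (\<Sum>i<n. w (flip Y i) * (f (flip Y i))\<^sup>2)
        - (\<Sum>i<n. w (flip Y i) * f (flip Y i))\<^sup>2 / (\<Sum>i<n. w (flip Y i)))"
    unfolding sum_subtractf[of _ _ "{..<n}"] sum_distrib_right[symmetric]
    by (simp add: g_def power2_eq_square)
  finally show ?thesis
    by (simp add: w_def Z_def)
qed

section \<open>The spectral gap as an attained supremum\<close>

lemma variance_on_eq_0_imp_constant:
  assumes "finite X" "\<And>x. x \<in> X \<Longrightarrow> 0 < \<mu> x" "variance_on X \<mu> f = 0" "x \<in> X"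
  shows "f x = mean_on X \<mu> f"
proof -
  have "\<forall>x\<in>X. \<mu> x * (f x - mean_on X \<mu> f)\<^sup>2 = 0"
    using assms unfolding variance_on_def mean_on_def[of _ _ "\<lambda>x. (f x - mean_on X \<mu> f)\<^sup>2"]
    by (subst (asm) sum_nonneg_eq_0_iff) (auto simp: less_imp_le)
  then show ?thesis
    using assms(2,4) by force
qed

lemma variance_on_nonneg:
  assumes "\<And>x. x \<in> X \<Longrightarrow> 0 < \<mu> x"
  shows "0 \<le> variance_on X \<mu> f"
  unfolding variance_on_def mean_on_def[of _ _ "\<lambda>x. (f x - mean_on X \<mu> f)\<^sup>2"]
  using assms by (intro sum_nonneg) (auto simp: less_imp_le)

text \<open>\<open>GREATEST\<close> is meaningful only if a maximum exists, so the admissible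
  constants are shown to be bounded and to contain their supremum. The convention for one state is
  why \<open>\<gamma> \<le> 1\<close> is assumed.\<close>

lemma spectral_gap_ge:
  assumes X: "finite X" "X \<noteq> {}" and pos: "\<And>x. x \<in> X \<Longrightarrow> 0 < \<mu> x" and "\<gamma> \<le> 1"
    and \<gamma>: "\<And>f. \<gamma> * variance_on X \<mu> f \<le> dirichlet_form X \<mu> P f"
  shows "\<gamma> \<le> spectral_gap X \<mu> P"
proof (cases "card X = 1")
  case True
  then show ?thesis
    using \<open>\<gamma> \<le> 1\<close> by (simp add: spectral_gap_def)
next
  case False
  define G where "G = {\<gamma>. \<forall>f. dirichlet_form X \<mu> P f \<ge> \<gamma> * variance_on X \<mu> f}"
  have "\<gamma> \<in> G" using \<gamma> by (simp add: G_def)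
  have "card X \<noteq> 0" using X by simp
  then have "2 \<le> card X" using False by linarith
  then obtain x y where xy: "x \<in> X" "y \<in> X" "x \<noteq> y"
    by (metis X(1) card_le_Suc0_iff_eq not_less_eq_eq numeral_2_eq_2)
  \<comment> \<open>An indicator that separates two states has positive variance, so its Rayleigh
    quotient bounds all admissible constants.\<close>
  define f where "f z = (of_bool (z = x) :: real)" for z
  have V: "0 < variance_on X \<mu> f"
  proof (rule ccontr)
    assume "\<not> 0 < variance_on X \<mu> f"
    then have "variance_on X \<mu> f = 0"
      using variance_on_nonneg[of X \<mu> f] pos by force
    then have "f x = f y"
      using variance_on_eq_0_imp_constant[of X \<mu> f] X pos xy by metis
    then show False using xy by (simp add: f_def)
  qed
  have bdd: "bdd_above G"
  proof (rule bdd_aboveI)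
    fix \<gamma>' assume "\<gamma>' \<in> G"
    then show "\<gamma>' \<le> dirichlet_form X \<mu> P f / variance_on X \<mu> f"
      using V by (simp add: G_def pos_le_divide_eq)
  qed
  have "Sup G \<in> {\<gamma>. \<forall>f. \<gamma> * variance_on X \<mu> f \<le> dirichlet_form X \<mu> P f}"
  proof (intro CollectI allI)
    fix h
    show "Sup G * variance_on X \<mu> h \<le> dirichlet_form X \<mu> P h"
    proof (cases "variance_on X \<mu> h = 0")
      case True
      then show ?thesis using \<gamma>[of h] by simp
    next
      case False
      then have "0 < variance_on X \<mu> h"
        using variance_on_nonneg[of X \<mu> h] pos by force
      then have "Sup G \<le> dirichlet_form X \<mu> P h / variance_on X \<mu> h"
        using \<open>\<gamma> \<in> G\<close> by (intro cSup_least) (auto simp: G_def pos_le_divide_eq)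
      then show ?thesis
        using \<open>0 < variance_on X \<mu> h\<close> by (simp add: pos_le_divide_eq)
    qed
  qed
  then have "spectral_gap X \<mu> P = Sup G"
    unfolding spectral_gap_def using False bdd
    by (auto simp: G_def[symmetric] intro!: Greatest_equality cSup_upper) (auto simp: G_def)
  then show ?thesis
    using \<open>\<gamma> \<in> G\<close> bdd by (simp add: cSup_upper)
qed

section \<open>The Poincare inequality for the walk\<close>

lemma partition_function_pos:
  assumes "A \<in> carrier_mat n n" "transpose_mat A = - A"
  shows "0 < partition_function A"
proof -
  have "partition_function A = ip n (pfaffian (entries A) n) (pfaffian (entries A) n)"
    using assms unfolding partition_function_def ip_def
    by (intro sum.cong) (auto simp: weight_eq_pfaffian_squared power2_eq_square)
  then show ?thesis by (simp add: norm_pfaffian_pos)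
qed

lemma empty_in_states:
  assumes "A \<in> carrier_mat n n" "transpose_mat A = - A"
  shows "{} \<in> states A"
  using weight_eq_pfaffian_squared[OF assms, of "{}"] by (simp add: states_def pfaffian_empty)

lemma flip_repair_poincare:
  assumes A: "A \<in> carrier_mat n n" and skew: "transpose_mat A = - A" and "0 < n"
  shows "2 / real n * variance_on (states A) (skew_det_measure A) f
    \<le> dirichlet_form (states A) (skew_det_measure A) (flip_repair A) f"
proof -
  let ?w = "weight A" and ?Z = "partition_function A"
  have w: "?w S = (pfaffian (entries A) n S)\<^sup>2" if "S \<subseteq> {..<n}" for S
    using A skew that by (rule weight_eq_pfaffian_squared)
  have dim: "dim_row A = n" using A by simp
  have states: "(\<Sum>S\<in>states A. ?w S * h S) = (\<Sum>S\<in>Pow {..<n}. ?w S * h S)" for h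
    unfolding dim[symmetric] using w dim by (intro sum_states) simp
  have mean: "mean_on (states A) (skew_det_measure A) h = (\<Sum>S\<in>Pow {..<n}. ?w S * h S) / ?Z" for h
    unfolding mean_on_def states[symmetric] sum_divide_distrib
    by (intro sum.cong) (auto simp: skew_det_measure_def)
  define m where "m = (\<Sum>S\<in>Pow {..<n}. ?w S * f S) / (\<Sum>S\<in>Pow {..<n}. ?w S)"
  have "(\<Sum>S\<in>Pow {..<n}. ?w S) = ?Z"
    by (simp add: partition_function_def dim)
  then have var: "variance_on (states A) (skew_det_measure A) f
      = (\<Sum>S\<in>Pow {..<n}. ?w S * (f S - m)\<^sup>2) / ?Z"
    by (simp add: variance_on_def mean m_def)
  let ?E = "\<Sum>Y\<in>Pow {..<n}. (\<Sum>i<n. ?w (flip Y i) * (f (flip Y i))\<^sup>2)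
        - (\<Sum>i<n. ?w (flip Y i) * f (flip Y i))\<^sup>2 / (\<Sum>i<n. ?w (flip Y i))"
  have flips: "flip Y i \<subseteq> {..<n}" if "Y \<in> Pow {..<n}" "i \<in> {..<n}" for Y i
    using that by (auto simp: flip_def)
  have sums: "(\<Sum>S\<in>Pow {..<n}. ?w S * h S) = (\<Sum>S\<in>Pow {..<n}. (pfaffian (entries A) n S)\<^sup>2 * h S)"
    "(\<Sum>S\<in>Pow {..<n}. ?w S) = (\<Sum>S\<in>Pow {..<n}. (pfaffian (entries A) n S)\<^sup>2)" for h
    by (intro sum.cong; simp add: w)+
  have E: "?E = (\<Sum>Y\<in>Pow {..<n}. (\<Sum>i<n. (pfaffian (entries A) n (flip Y i))\<^sup>2 * (f (flip Y i))\<^sup>2)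
        - (\<Sum>i<n. (pfaffian (entries A) n (flip Y i))\<^sup>2 * f (flip Y i))\<^sup>2
          / (\<Sum>i<n. (pfaffian (entries A) n (flip Y i))\<^sup>2))"
    by (intro sum.cong refl arg_cong2[where f = "(-)"] arg_cong2[where f = "(/)"]
        arg_cong[where f = "\<lambda>x. x\<^sup>2"]) (simp_all add: w flips)
  have "2 * (\<Sum>S\<in>Pow {..<n}. ?w S * (f S - m)\<^sup>2) \<le> ?E"
    unfolding E m_def sums by (rule poincare_pfaffian) (rule entries_skew[OF A skew])
  then have "2 * (\<Sum>S\<in>Pow {..<n}. ?w S * (f S - m)\<^sup>2) / (n * ?Z) \<le> ?E / (n * ?Z)"
    using partition_function_pos[OF A skew] by (intro divide_right_mono) auto
  moreover have "dirichlet_form (states A) (skew_det_measure A) (flip_repair A) f = ?E / (n * ?Z)"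
    using A \<open>0 < n\<close> w by (intro dirichlet_form_flip_repair) auto
  ultimately show ?thesis
    by (simp add: var)
qed

section \<open>Sharpness: a single pair\<close>

definition single_pair :: "nat \<Rightarrow> real mat" where
  "single_pair n = mat n n (\<lambda>(i,j). if i = 0 \<and> j = 1 then 1 else if i = 1 \<and> j = 0 then - 1 else 0)"

lemma single_pair_carrier: "single_pair n \<in> carrier_mat n n"
  by (simp add: single_pair_def)

lemma single_pair_skew: "transpose_mat (single_pair n) = - single_pair n"
  by (rule eq_matI) (auto simp: single_pair_def)

text \<open>Later rows do not affect sets without their index, so the value is settled at size two,
  where it is a signed entry; squaring removes the sign.\<close>

lemma pfaffian_pair_squared: "2 \<le> n \<Longrightarrow> (pfaffian a n {0, 1})\<^sup>2 = (a 1 0)\<^sup>2"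
proof (induction n rule: nat_induct_at_least)
  case base
  have flips: "flip {0, 1} (Suc 0) = {0}" "flip {0} 0 = {}"
    by (auto simp: flip_def)
  have "pfaffian a 2 {0, 1} = sgn_below 1 {0, 1} * (a 1 0 * sgn_below 0 {0})"
    by (simp add: numeral_2_eq_2 pfaffian_Suc_in flips[unfolded One_nat_def] clifford_def pfaffian_empty)
  then show ?case
    by (simp add: power_mult_distrib power2_eq_square[of "sgn_below _ _"] sgn_below_squared)
next
  case (Suc n)
  then show ?case by (simp add: pfaffian_Suc_notin)
qed

lemma weight_single_pair:
  assumes n: "2 \<le> n" and S: "S \<subseteq> {..<n}"
  shows "weight (single_pair n) S = of_bool (S = {} \<or> S = {0, 1})"
proof -
  let ?a = "entries (single_pair n)"
  \<comment> \<open>All nonzero entries lie in the block, so sets reaching outside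
    \<open>{0, 1}\<close> get weight zero; singletons vanish by parity.\<close>
  have a: "?a = restr ?a {0, 1}"
    using n by (auto simp: fun_eq_iff restr_def entries_def single_pair_def)
  have top: "(pfaffian ?a n {0, 1})\<^sup>2 = 1"
    unfolding pfaffian_pair_squared[OF n] using n by (simp add: entries_def restr_def single_pair_def)
  have w: "weight (single_pair n) S = (pfaffian ?a n S)\<^sup>2"
    using single_pair_carrier single_pair_skew S by (rule weight_eq_pfaffian_squared)
  show ?thesis
  proof (cases "S \<subseteq> {0, 1}")
    case False
    then show ?thesis
      using w pfaffian_restr[of ?a "{0, 1}" n S] a by auto
  next
    case True
    then have "S = {} \<or> S = {0, 1} \<or> S = {0} \<or> S = {1}" by auto
    then show ?thesis
      using w top pfaffian_odd[of S ?a n] by (auto simp: pfaffian_empty)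
  qed
qed

text \<open>Two equally likely states remain. The indicator of the empty set has variance
  \<open>1 / 4\<close> and Dirichlet form \<open>1 / (2 * n)\<close>, so nothing above the general
  bound is admissible.\<close>

lemma spectral_gap_single_pair:
  assumes n: "2 \<le> n"
  shows "spectral_gap (states (single_pair n)) (skew_det_measure (single_pair n))
    (flip_repair (single_pair n)) = 2 / real n"
proof -
  define A where "A = single_pair n"
  let ?X = "states A" and ?\<mu> = "skew_det_measure A" and ?P = "flip_repair A"
  have A: "A \<in> carrier_mat n n" "transpose_mat A = - A"
    by (simp_all add: A_def single_pair_carrier single_pair_skew)
  have dim: "dim_row A = n" using A by simp
  have w: "weight A S = of_bool (S = {} \<or> S = {0, 1})" if "S \<subseteq> {..<n}" for S
    unfolding A_def using n that by (rule weight_single_pair)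
  have pos: "0 < weight A S \<longleftrightarrow> S = {} \<or> S = {0, 1}" if "S \<subseteq> {..<n}" for S
    unfolding w[OF that] by (rule zero_less_of_bool_iff)
  have "?X = {S. S \<subseteq> {..<n} \<and> (S = {} \<or> S = {0, 1})}"
    unfolding states_def dim by (intro Collect_cong conj_cong refl pos)
  also have "\<dots> = {{}, {0, 1}}"
    using n by auto
  finally have X: "?X = {{}, {0, 1}}" .
  have "partition_function A = (\<Sum>S\<in>{{}, {0, 1}}. weight A S)"
    unfolding partition_function_def dim using n w by (intro sum.mono_neutral_right) auto
  also have "\<dots> = 2"
    using n w[of "{}"] w[of "{0, 1}"] by simp
  finally have Z: "partition_function A = 2" .
  have \<mu>: "?\<mu> {} = 1 / 2" "?\<mu> {0, 1} = 1 / 2"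
    using n w[of "{}"] w[of "{0, 1}"] by (simp_all add: skew_det_measure_def Z)
  define f where "f S = (of_bool (S = {}) :: real)" for S :: "nat set"
  have mean: "mean_on ?X ?\<mu> f = 1 / 2"
    using \<mu> by (simp add: mean_on_def X f_def)
  have V: "variance_on ?X ?\<mu> f = 1 / 4"
    unfolding variance_on_def mean using \<mu> by (simp add: mean_on_def X f_def power2_eq_square)
  have D: "dirichlet_form ?X ?\<mu> ?P f = 1 / (2 * n)"
  proof -
    let ?N = "\<lambda>Y. \<Sum>i<n. of_bool (i \<in> Y \<and> Y = {i}) :: real"
    let ?W = "\<lambda>Y. \<Sum>i<n. weight A (flip Y i)"
    have empty: "flip Y i = {} \<longleftrightarrow> i \<in> Y \<and> Y = {i}" for Y i
      by (auto simp: flip_def)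
    have wf: "weight A (flip Y i) * f (flip Y i) = of_bool (i \<in> Y \<and> Y = {i})"
      "weight A (flip Y i) * (f (flip Y i))\<^sup>2 = of_bool (i \<in> Y \<and> Y = {i})" if "i < n" for Y i
      using w[of "{}"] unfolding f_def empty[symmetric] by auto
    have "dirichlet_form ?X ?\<mu> ?P f
        = (\<Sum>Y\<in>Pow {..<n}. ?N Y - (?N Y)\<^sup>2 / ?W Y) / (n * partition_function A)"
      using n w by (subst dirichlet_form_flip_repair[OF A(1)]) (simp_all add: wf)
    also have "(\<Sum>Y\<in>Pow {..<n}. ?N Y - (?N Y)\<^sup>2 / ?W Y)
        = (\<Sum>Y\<in>(\<lambda>j. {j}) ` {..<n}. ?N Y - (?N Y)\<^sup>2 / ?W Y)"
    proof (intro sum.mono_neutral_right ballI)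
      fix Y assume "Y \<in> Pow {..<n} - (\<lambda>j. {j}) ` {..<n}"
      then have "?N Y = 0" by (intro sum.neutral) auto
      then show "?N Y - (?N Y)\<^sup>2 / ?W Y = 0" by simp
    qed auto
    also have "\<dots> = (\<Sum>j<n. ?N {j} - (?N {j})\<^sup>2 / ?W {j})"
      by (simp add: sum.reindex)
    \<comment> \<open>From \<open>{0}\<close> and \<open>{1}\<close> both states are reachable,
      which contributes \<open>1 / 2\<close> each; any other singleton can only be repaired to the
      empty set.\<close>
    also have "\<dots> = (\<Sum>j<n. if j < 2 then 1 / 2 else 0)"
    proof (intro sum.cong refl)
      fix j assume "j \<in> {..<n}"
      then have j: "j < n" by simp
      have "?N {j} = (\<Sum>i<n. of_bool (i = j) * 1)"
        by (intro sum.cong) auto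
      then have N: "?N {j} = 1"
        using j by (simp only: sum_of_bool_mult)
      \<comment> \<open>For \<open>j < 2\<close> the partner of \<open>j\<close> is
        \<open>1 - j\<close>; for larger \<open>j\<close> truncated subtraction gives 0 and the
        factor \<open>of_bool (j < 2)\<close> removes the term.\<close>
      have "weight A (flip {j} i) = of_bool (i = j) * 1 + of_bool (i = 1 - j) * of_bool (j < 2)"
        if "i < n" for i
      proof -
        have sub: "flip {j} i \<subseteq> {..<n}" using that j by (auto simp: flip_def)
        have none: "flip {j} i = {} \<longleftrightarrow> i = j" by (auto simp: flip_def)
        have pair: "flip {j} i = {0, 1} \<longleftrightarrow> j < 2 \<and> i = 1 - j"
        proof
          assume eq: "flip {j} i = {0, 1}"
          have "k \<in> {j, i}" if "k \<in> {0, 1}" for k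
            using that unfolding eq[symmetric] by (auto simp: flip_def)
          from this[of 0] this[of 1] show "j < 2 \<and> i = 1 - j"
            by (cases "i = 0"; cases "j = 0") simp_all
        next
          assume "j < 2 \<and> i = 1 - j"
          then have "j = 0 \<and> i = 1 \<or> j = 1 \<and> i = 0"
            by (cases "j = 0") simp_all
          then show "flip {j} i = {0, 1}"
            by (elim disjE conjE) (simp_all add: flip_def insert_commute)
        qed
        show ?thesis
          unfolding w[OF sub] none pair of_bool_def by (auto simp: less_2_cases_iff)
      qed
      then have "?W {j} = (\<Sum>i<n. of_bool (i = j) * 1) + (\<Sum>i<n. of_bool (i = 1 - j) * of_bool (j < 2))"
        by (simp add: sum.distrib)
      moreover have "1 - j < n" using n by simp
      ultimately have W: "?W {j} = 1 + of_bool (j < 2)"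
        using j by (simp only: sum_of_bool_mult)
      show "?N {j} - (?N {j})\<^sup>2 / ?W {j} = (if j < 2 then 1 / 2 else 0)"
        unfolding N W by simp
    qed
    also have "\<dots> = (\<Sum>j<2::nat. 1 / 2)"
      using n by (intro sum.mono_neutral_cong_right) auto
    finally show ?thesis
      by (simp add: Z)
  qed
  have "(GREATEST \<gamma>. \<forall>f. dirichlet_form ?X ?\<mu> ?P f \<ge> \<gamma> * variance_on ?X ?\<mu> f) = 2 / real n"
  proof (rule Greatest_equality)
    show "\<forall>f. 2 / real n * variance_on ?X ?\<mu> f \<le> dirichlet_form ?X ?\<mu> ?P f"
      using flip_repair_poincare[OF A] n by simp
  next
    fix \<gamma> assume "\<forall>f. \<gamma> * variance_on ?X ?\<mu> f \<le> dirichlet_form ?X ?\<mu> ?P f"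
    then have "\<gamma> * variance_on ?X ?\<mu> f \<le> dirichlet_form ?X ?\<mu> ?P f" by blast
    then show "\<gamma> \<le> 2 / real n"
      using n unfolding V D by (simp add: field_simps)
  qed
  moreover have "card ?X \<noteq> 1"
    by (simp add: X)
  ultimately show ?thesis
    by (simp add: spectral_gap_def A_def)
qed

theorem theorem4p1:
  fixes n :: nat
  assumes "n \<ge> 2"
  shows "(\<forall>A \<in> carrier_mat n n. transpose_mat A = - A \<longrightarrow>
           spectral_gap (states A) (skew_det_measure A) (flip_repair A) \<ge> 2 / real n \<and>
           (\<forall>f. dirichlet_form (states A) (skew_det_measure A) (flip_repair A) f
                \<ge> 2 / real n * variance_on (states A) (skew_det_measure A) f)) \<and>
         (\<exists>A \<in> carrier_mat n n. transpose_mat A = - A \<and>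
           spectral_gap (states A) (skew_det_measure A) (flip_repair A) = 2 / real n)"
proof (intro conjI ballI impI allI)
  fix A :: "real mat" assume A: "A \<in> carrier_mat n n" "transpose_mat A = - A"
  show gap: "2 / real n * variance_on (states A) (skew_det_measure A) f
      \<le> dirichlet_form (states A) (skew_det_measure A) (flip_repair A) f" for f
    using A assms by (intro flip_repair_poincare) auto
  have "finite (states A)"
    by (rule finite_subset[of _ "Pow {..<dim_row A}"]) (auto simp: states_def)
  \<comment> \<open>The case of a single state uses \<open>2 / n \<le> 1\<close>, that is
    \<open>n \<ge> 2\<close>.\<close>
  then show "2 / real n \<le> spectral_gap (states A) (skew_det_measure A) (flip_repair A)"
    using empty_in_states[OF A] partition_function_pos[OF A] gap assms
    by (intro spectral_gap_ge) (auto simp: skew_det_measure_def states_def)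
next
  show "\<exists>A \<in> carrier_mat n n. transpose_mat A = - A \<and>
      spectral_gap (states A) (skew_det_measure A) (flip_repair A) = 2 / real n"
    using single_pair_carrier single_pair_skew spectral_gap_single_pair[OF assms] by blast
qed

end
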